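(* For $t=1,\dots,T$ let $f_t:\mathbb R^{nt}\times\Omega\to\mathbb R^m$ be Carathéodory functions defining a causal operator $F:\mathcal X\to\mathcal Y$ whose extension $F:\widetilde{\mathcal X}\to\widetilde{\mathcal Y}$, given by the same formula $F_t(x)(\omega)=f_t(x_{1:t}(\omega),\omega)$, is Lipschitz continuous; and let $Y_t:\Omega\rightrightarrows\mathbb R^m$ and $X_t:\Omega\rightrightarrows\mathbb R^n$ be $\mathcal F_t$-measurable multifunctions with convex and closed values. If the system $$f_t(\zeta_{1:t-1},\xi,\omega)\in Y_t(\omega),\qquad \xi\in X_t(\omega)$$ admits complete subregular recourse (see context), then the system $$x_t-\mathbb E_t[x_t]=0\ \text{ a.s.},\qquad F_t(x_{1:t})\in\widetilde Y_t\ \text{ a.s.},\qquad x_t\in\widetilde X_t\ \text{ a.s.},\qquad t=1,\dots,T,$$ with unknown $x=(x_1,\dots,x_T)\in\widetilde{\mathcal X}$, is subregular at every feasible point $\hat x=(\hat x_1,\dots,\hat x_T)\in\widetilde{\mathcal X}$ (i.e., every $\hat x\in\widetilde{\mathcal X}$ satisfying this system).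
   Context: $(\Omega,\mathcal F,P)$ is a probability space with filtration $\{\emptyset,\Omega\}=\mathcal F_1\subset\dots\subset\mathcal F_T=\mathcal F$, $p\in[1,\infty)$. $\mathcal X_t=L_p(\Omega,\mathcal F_t,P;\mathbb R^n)$, $\mathcal Y_t=L_p(\Omega,\mathcal F_t,P;\mathbb R^m)$, $\mathcal X=\prod_t\mathcal X_t$, $\mathcal Y=\prod_t\mathcal Y_t$. The extended spaces are $\widetilde{\mathcal X}_t=L_p(\Omega,\mathcal F,P;\mathbb R^n)$, $\widetilde{\mathcal Y}_t=L_p(\Omega,\mathcal F,P;\mathbb R^m)$, $\widetilde{\mathcal X}=\widetilde{\mathcal X}_1\times\dots\times\widetilde{\mathcal X}_T$, $\widetilde{\mathcal Y}=\widetilde{\mathcal Y}_1\times\dots\times\widetilde{\mathcal Y}_T$, all with the $L_p$ norms. $x_{1:t}=(x_1,\dots,x_t)$ and $\mathbb E_t[\cdot]=\mathbb E[\cdot\,|\,\mathcal F_t]$. $F:\mathcal X\to\mathcal Y$ is causal if $F=(F_1,\dots,F_T)$ with $F_t(x)(\omega)=f_t(x_{1:t}(\omega),\omega)$ for superpositionally measurable functions $f_t$; one also writes $F_t(x_{1:t})$. Carathéodory means: $f_t(\xi,\cdot)$ is $\mathcal F_t$-measurable for each $\xi$ and $f_t(\cdot,\omega)$ is continuous for almost all $\omega$. $\widetilde X_t=\{x_t\in\widetilde{\mathcal X}_t:x_t(\omega)\in X_t(\omega)\text{ a.s.}\}$, $\widetilde Y_t=\{y_t\in\widetilde{\mathcal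 Y}_t:y_t(\omega)\in Y_t(\omega)\text{ a.s.}\}$. $\operatorname{dist}$ denotes distance to a set in a function space, $\mathsf d$ distance in a finite-dimensional space. Complete subregular recourse: there is a constant $C$ such that for every $t=1,\dots,T$, for almost all $\omega\in\Omega$, every $\zeta_{1:t-1}\in X_1(\omega)\times\dots\times X_{t-1}(\omega)$ and every $\eta\in\mathbb R^n$, there exists $\xi$ with $f_t(\zeta_{1:t-1},\xi,\omega)\in Y_t(\omega)$, $\xi\in X_t(\omega)$ and $$\|\xi-\eta\|\le C\big(\mathsf d(f_t(\zeta_{1:t-1},\eta,\omega),Y_t(\omega))+\mathsf d(\eta,X_t(\omega))\big).$$ (For $t=1$ the parameter $\zeta_{1:t-1}$ is absent.) Subregularity: for a multifunction $\mathfrak H:\widetilde{\mathcal X}\rightrightarrows\mathcal Z$ ($\mathcal Z$ Banach), the relation $0\in\mathfrak H(x)$ is subregular at $\hat x$ with $0\in\mathfrak H(\hat x)$ if there are $\delta>0$, $C>0$ such that for all $x$ with $\|x-\hat x\|\le\delta$ there is $\tilde x$ with $0\in\mathfrak H(\tilde x)$ and $\|\tilde x-x\|\le C\operatorname{dist}(0,\mathfrak H(x))$. For the system above, $\mathfrak H(x)=\prod_{t=1}^T\{x_t-\mathbb E_t[x_t]\}\times(F_t(x_{1:t})-\widetilde Y_t)\times(x_t-\widetilde X_t)$, so that (up to a change of the constant) $\operatorname{dist}(0,\mathfrak H(x))$ may be taken to be $\sum_{t=1}^T\big(\|x_t-\mathbb E_t[x_t]\|+\operatorname{dist}(F_t(x_{1:t}),\widetilde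 Y_t)+\operatorname{dist}(x_t,\widetilde X_t)\big)$. *)

theory Defs
  imports "HOL-Probability.Probability" "HOL-Library.Function_Algebras"
begin

text \<open>
  Conventions. Time runs over \<open>{1..T}\<close>, and \<open>M\<close> is the probability space \<open>(\<Omega>, \<F>, P)\<close>. The
  \<open>\<sigma>\<close>-algebras \<open>\<F>\<^sub>t\<close> are measures \<open>\<F> t\<close> of which only space and sets are used; all integrals are
  taken with respect to \<open>M\<close>. Elements of the \<open>L\<^sub>p\<close> spaces are represented by measurable functions
  (not by their classes modulo almost sure equality), so the norms below are seminorms.

  The space \<open>\<real>\<^bsup>nt\<^esup>\<close> is \<open>{1..t} \<rightarrow>\<^sub>E UNIV\<close> with values in \<^typ>\<open>real ^ 'n\<close>, carrying the subspace
  topology of the product topology; the vector \<open>(\<zeta>\<^sub>1, \<dots>, \<zeta>\<^bsub>t-1\<^esub>, \<xi>)\<close> is \<open>\<zeta>(t := \<xi>)\<close> with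
  \<open>\<zeta> \<in> {1..<t} \<rightarrow>\<^sub>E UNIV\<close>.
\<close>

definition filtration_upto :: "'w measure \<Rightarrow> (nat \<Rightarrow> 'w measure) \<Rightarrow> nat \<Rightarrow> bool" where
  "filtration_upto M \<F> T \<longleftrightarrow>
     (\<forall>t\<in>{1..T}. subalgebra M (\<F> t)) \<and>
     (\<forall>s\<in>{1..T}. \<forall>t\<in>{1..T}. s \<le> t \<longrightarrow> sets (\<F> s) \<subseteq> sets (\<F> t)) \<and>
     sets (\<F> 1) = {{}, space M} \<and>
     sets (\<F> T) = sets M"

section \<open>Function spaces\<close>

text \<open>\<open>Lp_space M N p\<close> is \<open>L\<^sub>p(\<Omega>, \<N>, P)\<close> for the sub-\<open>\<sigma>\<close>-algebra \<open>\<N>\<close> given by \<open>N\<close>.\<close>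

definition Lp_space ::
  "'w measure \<Rightarrow> 'w measure \<Rightarrow> real \<Rightarrow> ('w \<Rightarrow> 'a::euclidean_space) set" where
  "Lp_space M N p = {x \<in> borel_measurable N. integrable M (\<lambda>\<omega>. norm (x \<omega>) powr p)}"

definition Lp_norm :: "'w measure \<Rightarrow> real \<Rightarrow> ('w \<Rightarrow> 'a::euclidean_space) \<Rightarrow> real" where
  "Lp_norm M p x = (\<integral>\<omega>. norm (x \<omega>) powr p \<partial>M) powr (1 / p)"

text \<open>
  Processes are functions of a time index in \<^typ>\<open>nat\<close>; components outside \<open>{1..T}\<close> are unconstrained
  and never used. \<open>adapted_Lp\<close> is \<open>L\<^sub>p(\<F>\<^sub>1) \<times> \<dots> \<times> L\<^sub>p(\<F>\<^sub>T)\<close>, and \<open>process_Lp\<close> is its extension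
  \<open>L\<^sub>p(\<F>) \<times> \<dots> \<times> L\<^sub>p(\<F>)\<close>. The latter is normed by the sum of the \<open>L\<^sub>p\<close> norms of the components.
\<close>

definition adapted_Lp ::
  "'w measure \<Rightarrow> (nat \<Rightarrow> 'w measure) \<Rightarrow> real \<Rightarrow> nat \<Rightarrow> (nat \<Rightarrow> 'w \<Rightarrow> 'a::euclidean_space) set" where
  "adapted_Lp M \<F> p T = {x. \<forall>t\<in>{1..T}. x t \<in> Lp_space M (\<F> t) p}"

definition process_Lp ::
  "'w measure \<Rightarrow> real \<Rightarrow> nat \<Rightarrow> (nat \<Rightarrow> 'w \<Rightarrow> 'a::euclidean_space) set" where
  "process_Lp M p T = {x. \<forall>t\<in>{1..T}. x t \<in> Lp_space M M p}"

definition process_norm ::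
  "'w measure \<Rightarrow> real \<Rightarrow> nat \<Rightarrow> (nat \<Rightarrow> 'w \<Rightarrow> 'a::euclidean_space) \<Rightarrow> real" where
  "process_norm M p T x = (\<Sum>t\<in>{1..T}. Lp_norm M p (x t))"

text \<open>\<^const>\<open>real_cond_exp\<close> is available for real-valued functions only.\<close>

definition vec_cond_exp ::
  "'w measure \<Rightarrow> 'w measure \<Rightarrow> ('w \<Rightarrow> real ^ 'n) \<Rightarrow> 'w \<Rightarrow> real ^ 'n" where
  "vec_cond_exp M N x = (\<lambda>\<omega>. \<chi> i. real_cond_exp M N (\<lambda>\<omega>'. x \<omega>' $ i) \<omega>)"

section \<open>Causal operators\<close>

definition causal_op ::
  "(nat \<Rightarrow> (nat \<Rightarrow> 'a) \<Rightarrow> 'w \<Rightarrow> 'b) \<Rightarrow> (nat \<Rightarrow> 'w \<Rightarrow> 'a) \<Rightarrow> nat \<Rightarrow> 'w \<Rightarrow> 'b" where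
  "causal_op f x t = (\<lambda>\<omega>. f t (\<lambda>s\<in>{1..t}. x s \<omega>) \<omega>)"

definition caratheodory ::
  "'w measure \<Rightarrow> 'w measure \<Rightarrow> nat \<Rightarrow>
   ((nat \<Rightarrow> 'a::euclidean_space) \<Rightarrow> 'w \<Rightarrow> 'b::euclidean_space) \<Rightarrow> bool" where
  "caratheodory M N t g \<longleftrightarrow>
     (\<forall>\<zeta> \<in> {1..t} \<rightarrow>\<^sub>E UNIV. g \<zeta> \<in> borel_measurable N) \<and>
     (AE \<omega> in M. continuous_on ({1..t} \<rightarrow>\<^sub>E UNIV) (\<lambda>\<zeta>. g \<zeta> \<omega>))"

definition superpositionally_measurable ::
  "'w measure \<Rightarrow> nat \<Rightarrow>
   ((nat \<Rightarrow> 'a::euclidean_space) \<Rightarrow> 'w \<Rightarrow> 'b::euclidean_space) \<Rightarrow> bool" where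
  "superpositionally_measurable N t g \<longleftrightarrow>
     (\<forall>x \<in> measurable N (Pi\<^sub>M {1..t} (\<lambda>_. borel)). (\<lambda>\<omega>. g (x \<omega>) \<omega>) \<in> borel_measurable N)"

definition causal_operator ::
  "'w measure \<Rightarrow> (nat \<Rightarrow> 'w measure) \<Rightarrow> real \<Rightarrow> nat \<Rightarrow>
   (nat \<Rightarrow> (nat \<Rightarrow> 'a::euclidean_space) \<Rightarrow> 'w \<Rightarrow> 'b::euclidean_space) \<Rightarrow> bool" where
  "causal_operator M \<F> p T f \<longleftrightarrow>
     (\<forall>t\<in>{1..T}. superpositionally_measurable (\<F> t) t (f t)) \<and>
     (\<forall>x \<in> adapted_Lp M \<F> p T. causal_op f x \<in> adapted_Lp M \<F> p T)"

definition lipschitz_extension ::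
  "'w measure \<Rightarrow> real \<Rightarrow> nat \<Rightarrow>
   (nat \<Rightarrow> (nat \<Rightarrow> 'a::euclidean_space) \<Rightarrow> 'w \<Rightarrow> 'b::euclidean_space) \<Rightarrow> bool" where
  "lipschitz_extension M p T f \<longleftrightarrow>
     (\<forall>x \<in> process_Lp M p T. causal_op f x \<in> process_Lp M p T) \<and>
     (\<exists>L. \<forall>x \<in> process_Lp M p T. \<forall>x' \<in> process_Lp M p T.
        process_norm M p T (causal_op f x - causal_op f x') \<le> L * process_norm M p T (x - x'))"

section \<open>Multifunctions and recourse\<close>

definition measurable_multifunction :: "'w measure \<Rightarrow> ('w \<Rightarrow> 'a::euclidean_space set) \<Rightarrow> bool" where
  "measurable_multifunction N G \<longleftrightarrow>
     (\<forall>U. open U \<longrightarrow> {\<omega> \<in> space N. G \<omega> \<inter> U \<noteq> {}} \<in> sets N)"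

definition Lp_selections ::
  "'w measure \<Rightarrow> real \<Rightarrow> ('w \<Rightarrow> 'a::euclidean_space set) \<Rightarrow> ('w \<Rightarrow> 'a) set" where
  "Lp_selections M p G = {x \<in> Lp_space M M p. AE \<omega> in M. x \<omega> \<in> G \<omega>}"

text \<open>
  \<^const>\<open>infdist\<close> vanishes for an empty set; this does no harm here, since the required \<open>\<xi>\<close>
  already forces \<open>X t \<omega>\<close> and \<open>Y t \<omega>\<close> to be nonempty.
\<close>

definition complete_subregular_recourse ::
  "'w measure \<Rightarrow> nat \<Rightarrow> (nat \<Rightarrow> (nat \<Rightarrow> 'a::euclidean_space) \<Rightarrow> 'w \<Rightarrow> 'b::euclidean_space) \<Rightarrow>
   (nat \<Rightarrow> 'w \<Rightarrow> 'a set) \<Rightarrow> (nat \<Rightarrow> 'w \<Rightarrow> 'b set) \<Rightarrow> bool" where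
  "complete_subregular_recourse M T f X Y \<longleftrightarrow>
     (\<exists>C. \<forall>t\<in>{1..T}. AE \<omega> in M.
        \<forall>\<zeta> \<in> (\<Pi>\<^sub>E s\<in>{1..<t}. X s \<omega>). \<forall>\<eta>. \<exists>\<xi>.
          f t (\<zeta>(t := \<xi>)) \<omega> \<in> Y t \<omega> \<and> \<xi> \<in> X t \<omega> \<and>
          norm (\<xi> - \<eta>) \<le> C * (infdist (f t (\<zeta>(t := \<eta>)) \<omega>) (Y t \<omega>) + infdist \<eta> (X t \<omega>)))"

section \<open>Subregularity\<close>

text \<open>
  Subregularity of \<open>0 \<in> H x\<close> at \<open>xh\<close>, for a multifunction \<open>H\<close> on the (semi)normed space with carrier
  \<open>D\<close> and norm \<open>nX\<close>, with values in a space normed by \<open>nZ\<close>. The infimum is the distance of \<open>0\<close> to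
  \<open>H x\<close>, taken in \<^typ>\<open>ennreal\<close> so that it is \<open>\<infinity>\<close> if \<open>H x\<close> is empty.
\<close>

definition subregular_at ::
  "'x::ab_group_add set \<Rightarrow> ('x \<Rightarrow> real) \<Rightarrow> ('z::ab_group_add \<Rightarrow> real) \<Rightarrow> ('x \<Rightarrow> 'z set) \<Rightarrow> 'x \<Rightarrow> bool"
  where
  "subregular_at D nX nZ H xh \<longleftrightarrow>
     xh \<in> D \<and> 0 \<in> H xh \<and>
     (\<exists>\<delta>>0. \<exists>C>0. \<forall>x\<in>D. nX (x - xh) \<le> \<delta> \<longrightarrow>
        (\<exists>x'\<in>D. 0 \<in> H x' \<and> ennreal (nX (x' - x)) \<le> ennreal C * (INF z\<in>H x. ennreal (nZ z))))"

text \<open>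
  The multifunction \<open>x \<mapsto> \<Prod>\<^sub>t {x\<^sub>t - E\<^sub>t[x\<^sub>t]} \<times> (F\<^sub>t(x) - Y\<^sub>t) \<times> (x\<^sub>t - X\<^sub>t)\<close>, the factors being grouped by
  kind instead of by time. The singleton is the class of all \<open>L\<^sub>p\<close> functions almost surely equal to
  \<open>x\<^sub>t - E\<^sub>t[x\<^sub>t]\<close>. Measurability of these representatives is essential: the Bochner integral, and hence
  \<^const>\<open>Lp_norm\<close>, of a function that is not measurable can be \<open>0\<close>.
\<close>

definition residual ::
  "'w measure \<Rightarrow> (nat \<Rightarrow> 'w measure) \<Rightarrow> real \<Rightarrow> nat \<Rightarrow>
   (nat \<Rightarrow> (nat \<Rightarrow> real ^ 'n) \<Rightarrow> 'w \<Rightarrow> real ^ 'm) \<Rightarrow>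
   (nat \<Rightarrow> 'w \<Rightarrow> (real ^ 'n) set) \<Rightarrow> (nat \<Rightarrow> 'w \<Rightarrow> (real ^ 'm) set) \<Rightarrow>
   (nat \<Rightarrow> 'w \<Rightarrow> real ^ 'n) \<Rightarrow>
   ((nat \<Rightarrow> 'w \<Rightarrow> real ^ 'n) \<times> (nat \<Rightarrow> 'w \<Rightarrow> real ^ 'm) \<times> (nat \<Rightarrow> 'w \<Rightarrow> real ^ 'n)) set" where
  "residual M \<F> p T f X Y x = {(a, b, c). \<forall>t\<in>{1..T}.
     a t \<in> {u \<in> Lp_space M M p. AE \<omega> in M. u \<omega> = x t \<omega> - vec_cond_exp M (\<F> t) (x t) \<omega>} \<and>
     b t \<in> (\<lambda>y. causal_op f x t - y) ` Lp_selections M p (Y t) \<and>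
     c t \<in> (\<lambda>u. x t - u) ` Lp_selections M p (X t)}"

definition residual_norm ::
  "'w measure \<Rightarrow> real \<Rightarrow> nat \<Rightarrow>
   (nat \<Rightarrow> 'w \<Rightarrow> real ^ 'n) \<times> (nat \<Rightarrow> 'w \<Rightarrow> real ^ 'm) \<times> (nat \<Rightarrow> 'w \<Rightarrow> real ^ 'n) \<Rightarrow> real" where
  "residual_norm M p T = (\<lambda>(a, b, c).
     process_norm M p T a + process_norm M p T b + process_norm M p T c)"

definition feasible ::
  "'w measure \<Rightarrow> (nat \<Rightarrow> 'w measure) \<Rightarrow> real \<Rightarrow> nat \<Rightarrow>
   (nat \<Rightarrow> (nat \<Rightarrow> real ^ 'n) \<Rightarrow> 'w \<Rightarrow> real ^ 'm) \<Rightarrow>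
   (nat \<Rightarrow> 'w \<Rightarrow> (real ^ 'n) set) \<Rightarrow> (nat \<Rightarrow> 'w \<Rightarrow> (real ^ 'm) set) \<Rightarrow>
   (nat \<Rightarrow> 'w \<Rightarrow> real ^ 'n) \<Rightarrow> bool" where
  "feasible M \<F> p T f X Y x \<longleftrightarrow>
     x \<in> process_Lp M p T \<and>
     (\<forall>t\<in>{1..T}.
        (AE \<omega> in M. x t \<omega> - vec_cond_exp M (\<F> t) (x t) \<omega> = 0) \<and>
        causal_op f x t \<in> Lp_selections M p (Y t) \<and>
        x t \<in> Lp_selections M p (X t))"

text \<open>The system is the relation \<open>0 \<in> residual x\<close>.\<close>

lemma zero_in_residual_iff_feasible:
  fixes x :: "nat \<Rightarrow> 'w \<Rightarrow> real ^ 'n"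
  assumes "x \<in> process_Lp M p T"
  shows "0 \<in> residual M \<F> p T f X Y x \<longleftrightarrow> feasible M \<F> p T f X Y x"
proof -
  have zero: "(\<lambda>_. 0 :: real ^ 'n) \<in> Lp_space M M p"
    by (simp add: Lp_space_def)
  have diff: "0 \<in> (\<lambda>u. v - u) ` S \<longleftrightarrow> v \<in> S" for v :: "'w \<Rightarrow> real ^ 'k" and S
    by (auto simp: image_iff)
  show ?thesis
    using assms zero
    by (simp add: residual_def feasible_def zero_prod_def diff) (simp add: zero_fun_def)
qed

end

theory Submission
  imports Defs
begin

text \<open>
  Given a process \<open>x\<close>, a feasible process \<open>x'\<close> close to it is built forward in time. Let
  \<open>\<eta>\<^sub>t = E\<^sub>t[x\<^sub>t]\<close>, which repairs the failure of \<open>x\<^sub>t\<close> to be adapted. If \<open>x'\<close> has been found up to time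
  \<open>t - 1\<close> and satisfies the constraints there, complete recourse yields for almost every \<open>\<omega>\<close> a point
  \<open>\<xi>\<close> that satisfies the constraints of time \<open>t\<close> together with this past, and whose distance to
  \<open>\<eta>\<^sub>t(\<omega>)\<close> is at most \<open>C\<close> times the violation of these constraints by \<open>\<eta>\<^sub>t(\<omega>)\<close>. Such points have to
  be chosen in an \<open>\<F>\<^sub>t\<close>-measurable way (\<open>recourse_step\<close>). They form a compact set, which is in general
  not convex, so that there is no unique nearest point to take; the lexicographically smallest one is
  chosen instead (\<open>measurable_zero_selection\<close>). A component chosen in this way is
  \<open>\<F>\<^sub>t\<close>-measurable, hence almost surely equal to its own conditional expectation, and the process \<open>x'\<close>
  is feasible.

  For the distance to \<open>x\<close>, the violation of the constraints by \<open>\<eta>\<^sub>t\<close> under the corrected past is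
  compared with the violation by \<open>x\<close>. The Lipschitz property of the operator, applied to \<open>x\<close> and to
  the process \<open>(x'\<^sub>1, \<dots>, x'\<^bsub>t-1\<^esub>, \<eta>\<^sub>t, x\<^bsub>t+1\<^esub>, \<dots>, x\<^sub>T)\<close>, bounds the difference by a multiple of the
  corrections made so far and the norm of \<open>x\<^sub>t - \<eta>\<^sub>t\<close> (\<open>recourse_step_estimate\<close>). So the error at
  time \<open>t\<close> is at most a constant times the sum of the norm of the residual and the earlier errors,
  and \<open>discrete_Gronwall\<close> bounds the total error by a multiple of the norm of the residual.
\<close>

section \<open>The \<open>L\<^sub>p\<close> seminorm\<close>

text \<open>
  The convexity of \<open>x powr p\<close> on the open half-line extends to \<open>0\<close>, where it amounts to
  \<open>l powr p \<le> l\<close> for \<open>0 < l < 1\<close>.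
\<close>

lemma powr_convex_nonneg:
  fixes a b l p :: real
  assumes "1 \<le> p" "0 \<le> a" "0 \<le> b" "0 < l" "l < 1"
  shows "(l * a + (1 - l) * b) powr p \<le> l * a powr p + (1 - l) * b powr p"
proof -
  have scale: "(s * c) powr p \<le> s * c powr p" if "0 < s" "s < 1" "0 \<le> c" for s c :: real
  proof -
    have "s powr p \<le> s"
      using that assms(1) by (intro powr_le_one_le) auto
    then show ?thesis
      using that by (simp add: powr_mult mult_right_mono)
  qed
  consider "a = 0" | "b = 0" | "0 < a" "0 < b"
    using assms by fastforce
  then show ?thesis
  proof cases
    case 1
    then show ?thesis using scale[of "1 - l" b] assms by simp
  next
    case 2
    then show ?thesis using scale[of l a] assms by simp
  next
    case 3
    then show ?thesis
      using convex_onD[OF powr_convex[OF assms(1)], of "1 - l" a b] assms by simp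
  qed
qed

text \<open>
  This is convexity for the point \<open>(a + b) / (A + B)\<close>, which is the combination of \<open>a / A\<close> and
  \<open>b / B\<close> with weights \<open>A / (A + B)\<close> and \<open>B / (A + B)\<close>. With \<open>A\<close>, \<open>B\<close> bounds for the \<open>L\<^sub>p\<close> norms of two
  functions, the right-hand side integrates to at most \<open>(A + B) powr p\<close>; this is how Minkowski's
  inequality is obtained.
\<close>

lemma powr_sum_le_weighted:
  fixes a b A B p :: real
  assumes "1 \<le> p" "0 \<le> a" "0 \<le> b" "0 < A" "0 < B"
  shows "(a + b) powr p \<le> (A + B) powr p *
           (A / (A + B) * (a powr p / A powr p) + B / (A + B) * (b powr p / B powr p))"
proof -
  define l where "l = A / (A + B)"
  have l: "0 < l" "l < 1" and l': "1 - l = B / (A + B)"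
    using assms by (auto simp: l_def field_simps)
  have "(a + b) = (A + B) * (l * (a / A) + (1 - l) * (b / B))"
  proof -
    have "(A + B) * (l * (a / A)) = a" "(A + B) * ((1 - l) * (b / B)) = b"
      unfolding l' unfolding l_def using assms by simp_all
    then show ?thesis
      by (simp only: distrib_left)
  qed
  then have "(a + b) powr p = (A + B) powr p * (l * (a / A) + (1 - l) * (b / B)) powr p"
    using assms l by (simp add: powr_mult)
  also have "\<dots> \<le> (A + B) powr p * (l * (a / A) powr p + (1 - l) * (b / B) powr p)"
    using assms l by (intro mult_left_mono powr_convex_nonneg) auto
  finally show ?thesis
    using assms unfolding l' unfolding l_def by (simp add: powr_divide)
qed

lemma Lp_norm_nonneg: "0 \<le> Lp_norm M p u"
  by (simp add: Lp_norm_def)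

lemma Lp_norm_powr:
  assumes "0 < p"
  shows "(\<integral>\<omega>. norm (u \<omega>) powr p \<partial>M) = Lp_norm M p u powr p"
  using assms by (simp add: Lp_norm_def powr_powr)

lemma Lp_norm_leI:
  assumes "0 < p" "0 \<le> B" "(\<integral>\<omega>. norm (u \<omega>) powr p \<partial>M) \<le> B powr p"
  shows "Lp_norm M p u \<le> B"
proof -
  have "Lp_norm M p u \<le> (B powr p) powr (1 / p)"
    unfolding Lp_norm_def using assms by (intro powr_mono2) auto
  then show ?thesis
    using assms by (simp add: powr_powr)
qed

text \<open>
  The two functions may have values in different spaces. This is what allows the length of a
  correction in the \<open>\<xi>\<close>-space to be bounded by a residual in the space of the constraint.
\<close>

lemma Lp_dominated:
  fixes u :: "'w \<Rightarrow> 'a::euclidean_space" and v :: "'w \<Rightarrow> 'b::euclidean_space"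
  assumes "0 < p" and u: "u \<in> Lp_space M M p" and v: "v \<in> borel_measurable M"
    and le: "AE \<omega> in M. norm (v \<omega>) \<le> norm (u \<omega>)"
  shows "v \<in> Lp_space M M p" and "Lp_norm M p v \<le> Lp_norm M p u"
proof -
  have le': "AE \<omega> in M. norm (v \<omega>) powr p \<le> norm (u \<omega>) powr p"
    using le by eventually_elim (use \<open>0 < p\<close> in \<open>simp add: powr_mono2\<close>)
  have ui: "integrable M (\<lambda>\<omega>. norm (u \<omega>) powr p)"
    using u by (simp add: Lp_space_def)
  have vi: "integrable M (\<lambda>\<omega>. norm (v \<omega>) powr p)"
    by (rule Bochner_Integration.integrable_bound[OF ui]) (use v le' in auto)
  show "v \<in> Lp_space M M p"
    using v vi by (simp add: Lp_space_def)
  show "Lp_norm M p v \<le> Lp_norm M p u"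
    unfolding Lp_norm_def using vi ui le' \<open>0 < p\<close>
    by (intro powr_mono2 integral_mono_AE) auto
qed

lemma Lp_norm_cong_AE:
  fixes u v :: "'w \<Rightarrow> 'a::euclidean_space"
  assumes "u \<in> borel_measurable M" "v \<in> borel_measurable M" "AE \<omega> in M. u \<omega> = v \<omega>"
  shows "Lp_norm M p u = Lp_norm M p v"
proof -
  have "(\<integral>\<omega>. norm (u \<omega>) powr p \<partial>M) = (\<integral>\<omega>. norm (v \<omega>) powr p \<partial>M)"
    using assms by (intro integral_cong_AE) auto
  then show ?thesis by (simp add: Lp_norm_def)
qed

lemma Minkowski_Lp:
  fixes u v :: "'w \<Rightarrow> 'a::euclidean_space"
  assumes "1 \<le> p" and u: "u \<in> Lp_space M M p" and v: "v \<in> Lp_space M M p"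
  shows "(\<lambda>\<omega>. u \<omega> + v \<omega>) \<in> Lp_space M M p"
    and "Lp_norm M p (\<lambda>\<omega>. u \<omega> + v \<omega>) \<le> Lp_norm M p u + Lp_norm M p v"
proof -
  let ?w = "\<lambda>\<omega>. u \<omega> + v \<omega>"
  have um: "u \<in> borel_measurable M" and vm: "v \<in> borel_measurable M"
    and ui: "integrable M (\<lambda>\<omega>. norm (u \<omega>) powr p)"
    and vi: "integrable M (\<lambda>\<omega>. norm (v \<omega>) powr p)"
    using u v by (auto simp: Lp_space_def)
  define g where "g = (\<lambda>A B \<omega>. (A + B) powr p *
      (A / (A + B) * (norm (u \<omega>) powr p / A powr p) + B / (A + B) * (norm (v \<omega>) powr p / B powr p)))"
  have gi: "integrable M (g A B)" for A B
    unfolding g_def using ui vi by auto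
  have wg: "norm (?w \<omega>) powr p \<le> g A B \<omega>" if "0 < A" "0 < B" for A B \<omega>
  proof -
    have "norm (?w \<omega>) powr p \<le> (norm (u \<omega>) + norm (v \<omega>)) powr p"
      using assms(1) by (intro powr_mono2) (auto simp: norm_triangle_ineq)
    also have "\<dots> \<le> g A B \<omega>"
      unfolding g_def using that assms(1) by (intro powr_sum_le_weighted) auto
    finally show ?thesis .
  qed
  have wi: "integrable M (\<lambda>\<omega>. norm (?w \<omega>) powr p)"
    by (rule Bochner_Integration.integrable_bound[OF gi[of 1 1]])
      (use um vm wg[of 1 1] in \<open>auto intro!: AE_I2 order_trans[OF _ abs_ge_self]\<close>)
  then show "?w \<in> Lp_space M M p"
    using um vm by (simp add: Lp_space_def)
  \<comment> \<open>Strict bounds are positive, hence legitimate denominators, even if one of the norms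
    is \<open>0\<close>.\<close>
  have strict: "Lp_norm M p ?w \<le> A + B" if "Lp_norm M p u < A" "Lp_norm M p v < B" for A B
  proof -
    have pos: "0 < A" "0 < B"
      using that Lp_norm_nonneg le_less_trans by blast+
    have "(\<integral>\<omega>. norm (?w \<omega>) powr p \<partial>M) \<le> (\<integral>\<omega>. g A B \<omega> \<partial>M)"
      using wi gi wg[OF pos] by (intro integral_mono) auto
    also have "\<dots> = (A + B) powr p * (A / (A + B) * (Lp_norm M p u powr p / A powr p)
        + B / (A + B) * (Lp_norm M p v powr p / B powr p))"
      unfolding g_def using ui vi assms(1) by (simp add: Lp_norm_powr)
    also have "\<dots> \<le> (A + B) powr p * (A / (A + B) * 1 + B / (A + B) * 1)"
      using pos that assms(1)
      by (intro mult_left_mono add_mono) (auto simp: divide_le_eq_1 Lp_norm_nonneg intro!: powr_mono2)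
    also have "\<dots> = (A + B) powr p"
      using pos by (simp add: add_divide_distrib[symmetric])
    finally show ?thesis
      using pos assms(1) by (intro Lp_norm_leI) auto
  qed
  show "Lp_norm M p ?w \<le> Lp_norm M p u + Lp_norm M p v"
  proof (rule field_le_epsilon)
    fix e :: real assume "0 < e"
    then show "Lp_norm M p ?w \<le> Lp_norm M p u + Lp_norm M p v + e"
      using strict[of "Lp_norm M p u + e / 2" "Lp_norm M p v + e / 2"] by simp
  qed
qed

lemma Lp_uminus:
  fixes u :: "'w \<Rightarrow> 'a::euclidean_space"
  assumes "u \<in> Lp_space M M p"
  shows "(\<lambda>\<omega>. - u \<omega>) \<in> Lp_space M M p" and "Lp_norm M p (\<lambda>\<omega>. - u \<omega>) = Lp_norm M p u"
  using assms by (auto simp: Lp_space_def Lp_norm_def)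

lemma Lp_diff:
  fixes u v :: "'w \<Rightarrow> 'a::euclidean_space"
  assumes "1 \<le> p" "u \<in> Lp_space M M p" "v \<in> Lp_space M M p"
  shows "(\<lambda>\<omega>. u \<omega> - v \<omega>) \<in> Lp_space M M p"
  using Minkowski_Lp(1)[OF assms(1,2) Lp_uminus(1)[OF assms(3)]] by simp

lemma Lp_norm_of_norm:
  fixes u :: "'w \<Rightarrow> 'a::euclidean_space"
  assumes "u \<in> Lp_space M M p"
  shows "(\<lambda>\<omega>. norm (u \<omega>)) \<in> Lp_space M M p" and "Lp_norm M p (\<lambda>\<omega>. norm (u \<omega>)) = Lp_norm M p u"
  using assms by (auto simp: Lp_space_def Lp_norm_def)

lemma Lp_scale:
  fixes u :: "'w \<Rightarrow> 'a::euclidean_space"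
  assumes "0 < p" "u \<in> Lp_space M M p" "0 \<le> c"
  shows "(\<lambda>\<omega>. c *\<^sub>R u \<omega>) \<in> Lp_space M M p" and "Lp_norm M p (\<lambda>\<omega>. c *\<^sub>R u \<omega>) = c * Lp_norm M p u"
proof -
  show "(\<lambda>\<omega>. c *\<^sub>R u \<omega>) \<in> Lp_space M M p"
    using assms by (auto simp: Lp_space_def powr_mult)
  show "Lp_norm M p (\<lambda>\<omega>. c *\<^sub>R u \<omega>) = c * Lp_norm M p u"
    using assms by (simp add: Lp_norm_def powr_mult powr_powr)
qed

lemma Lp_imp_integrable:
  fixes u :: "'w \<Rightarrow> 'a::euclidean_space"
  assumes "prob_space M" "1 \<le> p" "u \<in> Lp_space M M p"
  shows "integrable M u"
proof -
  interpret prob_space M by fact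
  have i: "integrable M (\<lambda>\<omega>. 1 + norm (u \<omega>) powr p)"
    using assms(3) by (auto simp: Lp_space_def)
  have "norm (u \<omega>) \<le> 1 + norm (u \<omega>) powr p" for \<omega>
  proof (cases "norm (u \<omega>) \<le> 1")
    case False
    then have "norm (u \<omega>) powr 1 \<le> norm (u \<omega>) powr p"
      using assms(2) by (intro powr_mono) auto
    then show ?thesis using False by auto
  qed (simp add: add_increasing2)
  then show ?thesis
    by (intro Bochner_Integration.integrable_bound[OF i])
      (use assms(3) in \<open>auto simp: Lp_space_def intro!: AE_I2 order_trans[OF _ abs_ge_self]\<close>)
qed

section \<open>Measurable selection of zeros\<close>

text \<open>
  For a fixed point \<open>q\<close>, the event \<open>infdist q (G \<omega>) < c\<close> says that \<open>G \<omega>\<close> meets the ball around \<open>q\<close>,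
  which is measurable by hypothesis; empty values have distance \<open>0\<close> and form the measurable
  complement of the event that \<open>G \<omega>\<close> meets the whole space. A random point is then approximated
  by the points of a countable dense set, the distance being 1-Lipschitz.
\<close>

lemma borel_measurable_infdist_multifunction:
  fixes G :: "'w \<Rightarrow> 'a::euclidean_space set"
  assumes G: "measurable_multifunction N G" and u: "u \<in> borel_measurable N"
  shows "(\<lambda>\<omega>. infdist (u \<omega>) (G \<omega>)) \<in> borel_measurable N"
proof -
  have hit: "{\<omega> \<in> space N. G \<omega> \<inter> U \<noteq> {}} \<in> sets N" if "open U" for U
    using G that by (simp add: measurable_multifunction_def)
  obtain D :: "'a set" where D: "countable D" "\<And>X. open X \<Longrightarrow> X \<noteq> {} \<Longrightarrow> \<exists>d\<in>D. d \<in> X"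
    using countable_dense_exists[where 'a='a] by blast
  have point: "(\<lambda>\<omega>. infdist q (G \<omega>)) \<in> borel_measurable N" for q
  proof (rule borel_measurableI_less)
    fix c :: real
    have "{\<omega> \<in> space N. infdist q (G \<omega>) < c} =
        {\<omega> \<in> space N. G \<omega> \<inter> ball q c \<noteq> {}} \<union>
        (if 0 < c then space N - {\<omega> \<in> space N. G \<omega> \<inter> UNIV \<noteq> {}} else {})" (is "?L = ?R")
    proof (intro set_eqI)
      fix \<omega>
      show "\<omega> \<in> ?L \<longleftrightarrow> \<omega> \<in> ?R"
      proof (cases "G \<omega> = {}")
        case True
        then show ?thesis by (auto simp: infdist_def)
      next
        case False
        have "infdist q (G \<omega>) < c \<longleftrightarrow> G \<omega> \<inter> ball q c \<noteq> {}"
          using False by (auto simp: infdist_def cINF_less_iff)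
        then show ?thesis using False by auto
      qed
    qed
    also have "\<dots> \<in> sets N"
      using hit[of "ball q c"] hit[of UNIV] by auto
    finally show "{\<omega> \<in> space N. infdist q (G \<omega>) < c} \<in> sets N" .
  qed
  show ?thesis
  proof (rule borel_measurableI_less)
    fix c :: real
    have "{\<omega> \<in> space N. infdist (u \<omega>) (G \<omega>) < c} =
        {\<omega> \<in> space N. \<exists>q\<in>D. dist (u \<omega>) q + infdist q (G \<omega>) < c}"
    proof (intro Collect_cong conj_cong refl iffI)
      fix \<omega>
      assume "infdist (u \<omega>) (G \<omega>) < c"
      define r where "r = (c - infdist (u \<omega>) (G \<omega>)) / 2"
      have "0 < r"
        using \<open>infdist (u \<omega>) (G \<omega>) < c\<close> by (simp add: r_def)
      then obtain q where q: "q \<in> D" "dist (u \<omega>) q < r"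
        using D(2)[of "ball (u \<omega>) r"] by auto
      have "infdist q (G \<omega>) \<le> infdist (u \<omega>) (G \<omega>) + dist (u \<omega>) q"
        using infdist_triangle[of q "G \<omega>" "u \<omega>"] by (simp add: dist_commute)
      moreover have "infdist (u \<omega>) (G \<omega>) + 2 * r = c"
        by (simp add: r_def field_simps)
      ultimately have "dist (u \<omega>) q + infdist q (G \<omega>) < c"
        using q(2) by linarith
      then show "\<exists>q\<in>D. dist (u \<omega>) q + infdist q (G \<omega>) < c"
        using q(1) by blast
    next
      fix \<omega>
      assume "\<exists>q\<in>D. dist (u \<omega>) q + infdist q (G \<omega>) < c"
      then obtain q where "dist (u \<omega>) q + infdist q (G \<omega>) < c"
        by blast
      then show "infdist (u \<omega>) (G \<omega>) < c"
        using infdist_triangle[of "u \<omega>" "G \<omega>" q] by linarith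
    qed
    also have "\<dots> \<in> sets N"
    proof -
      have [measurable]: "u \<in> borel_measurable N" "(\<lambda>\<omega>. infdist q (G \<omega>)) \<in> borel_measurable N" for q
        using u point by auto
      have [simp]: "countable D" by fact
      show ?thesis by measurable
    qed
    finally show "{\<omega> \<in> space N. infdist (u \<omega>) (G \<omega>) < c} \<in> sets N" .
  qed
qed

text \<open>
  Continuity and existence of zeros are required on an arbitrary set \<open>G\<close> only, because the null set
  on which they fail is in general not an event of the \<open>\<sigma>\<close>-algebra with respect to which the
  selection has to be measurable. Measurability comes from a formula (\<open>E\<close> in the proof) that evaluates
  \<open>h\<close> at countably many points and is measurable everywhere, while on \<open>G\<close> it expresses, by compactness
  of balls, that some zero \<open>\<xi>\<close> has \<open>\<phi> \<xi> \<le> c\<close>.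
\<close>

lemma measurable_minimum_over_zeros:
  fixes h :: "'w \<Rightarrow> 'a::euclidean_space \<Rightarrow> real" and \<phi> :: "'a \<Rightarrow> real"
  assumes meas: "\<And>\<xi>. (\<lambda>\<omega>. h \<omega> \<xi>) \<in> borel_measurable N"
    and cont: "\<And>\<omega>. \<omega> \<in> G \<Longrightarrow> continuous_on UNIV (h \<omega>)"
    and nonneg: "\<And>\<omega> \<xi>. \<omega> \<in> G \<Longrightarrow> 0 \<le> h \<omega> \<xi>"
    and ex: "\<And>\<omega>. \<omega> \<in> G \<Longrightarrow> \<exists>\<xi>. h \<omega> \<xi> = 0"
    and bdd: "\<And>\<omega>. \<omega> \<in> G \<Longrightarrow> bounded {\<xi>. h \<omega> \<xi> = 0}"
    and \<phi>: "continuous_on UNIV \<phi>"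
  shows "\<exists>\<alpha>\<in>borel_measurable N. \<forall>\<omega>\<in>G. \<exists>\<xi>. h \<omega> \<xi> = 0 \<and> \<phi> \<xi> = \<alpha> \<omega>"
proof -
  obtain D :: "'a set" where D: "countable D" "\<And>X. open X \<Longrightarrow> X \<noteq> {} \<Longrightarrow> \<exists>d\<in>D. d \<in> X"
    using countable_dense_exists[where 'a='a] by blast
  define E where "E = (\<lambda>c \<omega>. \<exists>n::nat. \<forall>k::nat. \<exists>q\<in>D.
      norm q \<le> real n \<and> h \<omega> q < 1 / real (Suc k) \<and> \<phi> q < c + 1 / real (Suc k))"
  have E_iff: "E c \<omega> \<longleftrightarrow> (\<exists>\<xi>. h \<omega> \<xi> = 0 \<and> \<phi> \<xi> \<le> c)" if "\<omega> \<in> G" for c \<omega>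
  proof
    assume "E c \<omega>"
    then obtain n q where q: "norm (q k) \<le> real n" "h \<omega> (q k) < 1 / real (Suc k)"
        "\<phi> (q k) < c + 1 / real (Suc k)" for k :: nat
      unfolding E_def by metis
    have "q k \<in> cball 0 (real n)" for k
      using q(1) by simp
    then obtain \<xi> r where r: "strict_mono r" "(q \<circ> r) \<longlonglongrightarrow> \<xi>"
      using compact_cball[of "0::'a" "real n"] unfolding compact_def by blast
    have lim0: "(\<lambda>k. 1 / real (Suc (r k))) \<longlonglongrightarrow> 0"
      using LIMSEQ_subseq_LIMSEQ[OF LIMSEQ_Suc[OF lim_1_over_n] r(1)] by (simp add: o_def)
    have lh: "(\<lambda>k. h \<omega> (q (r k))) \<longlonglongrightarrow> h \<omega> \<xi>"
      using continuous_on_tendsto_compose[OF cont[OF that] r(2)] by (simp add: o_def)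
    have lp: "(\<lambda>k. \<phi> (q (r k))) \<longlonglongrightarrow> \<phi> \<xi>"
      using continuous_on_tendsto_compose[OF \<phi> r(2)] by (simp add: o_def)
    have "h \<omega> \<xi> \<le> 0"
      by (rule LIMSEQ_le[OF lh lim0]) (use q(2) less_imp_le in blast)
    moreover have "\<phi> \<xi> \<le> c + 0"
      by (rule LIMSEQ_le[OF lp tendsto_add[OF tendsto_const lim0]]) (use q(3) less_imp_le in blast)
    ultimately show "\<exists>\<xi>. h \<omega> \<xi> = 0 \<and> \<phi> \<xi> \<le> c"
      using nonneg[OF that, of \<xi>] by (intro exI[of _ \<xi>]) auto
  next
    assume "\<exists>\<xi>. h \<omega> \<xi> = 0 \<and> \<phi> \<xi> \<le> c"
    then obtain \<xi> where \<xi>: "h \<omega> \<xi> = 0" "\<phi> \<xi> \<le> c"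
      by blast
    obtain n :: nat where n: "norm \<xi> < real n"
      using reals_Archimedean2 by blast
    have "\<exists>q\<in>D. norm q \<le> real n \<and> h \<omega> q < 1 / real (Suc k) \<and> \<phi> q < c + 1 / real (Suc k)" for k
    proof -
      let ?U = "ball 0 (real n) \<inter> h \<omega> -` {..<1 / real (Suc k)} \<inter> \<phi> -` {..<c + 1 / real (Suc k)}"
      have "open ?U"
        using cont[OF that] \<phi> by (intro open_Int open_vimage) auto
      moreover have "\<xi> \<in> ?U"
        using \<xi> n by (simp add: add_le_less_mono[of "\<phi> \<xi>" c 0, simplified])
      ultimately obtain q where "q \<in> D" "q \<in> ?U"
        using D(2)[of ?U] by blast
      then show ?thesis
        by (intro bexI[of _ q]) auto
    qed
    then show "E c \<omega>"
      unfolding E_def by blast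
  qed
  \<comment> \<open>The infimum is taken in \<^typ>\<open>ereal\<close> so that it is measurable also where no rational
    \<open>c\<close>, or every rational \<open>c\<close>, satisfies \<open>E c \<omega>\<close>.\<close>
  define \<alpha>' where "\<alpha>' = (\<lambda>\<omega>. INF c\<in>\<rat>. if E c \<omega> then ereal c else \<infinity>)"
  have [measurable]: "\<alpha>' \<in> borel_measurable N"
  proof -
    have [measurable]: "(\<lambda>\<omega>. h \<omega> \<xi>) \<in> borel_measurable N" for \<xi> by fact
    have [simp]: "countable D" by fact
    have E: "Measurable.pred N (E c)" for c
      unfolding E_def by measurable
    show ?thesis
      unfolding \<alpha>'_def using E by (intro borel_measurable_INF countable_rat measurable_If) auto
  qed
  show ?thesis
  proof (intro bexI[of _ "\<lambda>\<omega>. real_of_ereal (\<alpha>' \<omega>)"] ballI)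
    fix \<omega> assume G: "\<omega> \<in> G"
    let ?Z = "{\<xi>. h \<omega> \<xi> = 0}"
    have "closed ?Z"
      using continuous_closed_preimage[OF cont[OF G] closed_UNIV, of "{0}"] by (simp add: vimage_def)
    then have "compact ?Z"
      using bdd[OF G] by (simp add: compact_eq_bounded_closed)
    then obtain \<xi> where \<xi>: "h \<omega> \<xi> = 0" "\<And>\<xi>'. h \<omega> \<xi>' = 0 \<Longrightarrow> \<phi> \<xi> \<le> \<phi> \<xi>'"
      using continuous_attains_inf[of ?Z \<phi>] ex[OF G] continuous_on_subset[OF \<phi>] by auto
    have "\<alpha>' \<omega> = ereal (\<phi> \<xi>)"
    proof (rule antisym)
      show "ereal (\<phi> \<xi>) \<le> \<alpha>' \<omega>"
        unfolding \<alpha>'_def using \<xi>(2) by (intro INF_greatest) (auto simp: E_iff[OF G] intro: order_trans)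
      show "\<alpha>' \<omega> \<le> ereal (\<phi> \<xi>)"
      proof (rule ereal_le_epsilon2)
        fix e :: real assume "0 < e"
        then obtain c where c: "c \<in> \<rat>" "\<phi> \<xi> < c" "c < \<phi> \<xi> + e"
          using Rats_dense_in_real[of "\<phi> \<xi>" "\<phi> \<xi> + e"] by auto
        then have "E c \<omega>"
          using \<xi>(1) by (auto simp: E_iff[OF G] intro!: exI[of _ \<xi>])
        then have "\<alpha>' \<omega> \<le> ereal c"
          unfolding \<alpha>'_def using c(1) by (intro INF_lower2[of c]) auto
        also have "\<dots> \<le> ereal (\<phi> \<xi>) + ereal e"
          using c(3) by simp
        finally show "\<alpha>' \<omega> \<le> ereal (\<phi> \<xi>) + ereal e" .
      qed
    qed
    then show "\<exists>\<xi>. h \<omega> \<xi> = 0 \<and> \<phi> \<xi> = real_of_ereal (\<alpha>' \<omega>)"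
      using \<xi>(1) by auto
  qed measurable
qed

text \<open>
  The selection is the lexicographically smallest zero. Adding \<open>\<bar>\<xi> \<bullet> b - \<beta> \<omega>\<bar>\<close>, with \<open>\<beta> \<omega>\<close> the least
  value of the coordinate \<open>\<xi> \<bullet> b\<close> over the zeros of \<open>h \<omega>\<close>, keeps exactly the zeros that attain this
  minimum. After all coordinates have been treated a single zero is left, and its coordinates are
  measurable because they are the successive minima.
\<close>

lemma measurable_zero_selection:
  fixes h :: "'w \<Rightarrow> 'a::euclidean_space \<Rightarrow> real"
  assumes meas: "\<And>\<xi>. (\<lambda>\<omega>. h \<omega> \<xi>) \<in> borel_measurable N"
    and cont: "\<And>\<omega>. \<omega> \<in> G \<Longrightarrow> continuous_on UNIV (h \<omega>)"
    and nonneg: "\<And>\<omega> \<xi>. \<omega> \<in> G \<Longrightarrow> 0 \<le> h \<omega> \<xi>"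
    and ex: "\<And>\<omega>. \<omega> \<in> G \<Longrightarrow> \<exists>\<xi>. h \<omega> \<xi> = 0"
    and bdd: "\<And>\<omega>. \<omega> \<in> G \<Longrightarrow> bounded {\<xi>. h \<omega> \<xi> = 0}"
  shows "\<exists>z\<in>borel_measurable N. \<forall>\<omega>\<in>G. h \<omega> (z \<omega>) = 0"
proof -
  have "\<exists>(h' :: 'w \<Rightarrow> 'a \<Rightarrow> real) \<alpha>. (\<forall>\<xi>. (\<lambda>\<omega>. h' \<omega> \<xi>) \<in> borel_measurable N) \<and> (\<forall>b\<in>B. \<alpha> b \<in> borel_measurable N) \<and>
      (\<forall>\<omega>\<in>G. continuous_on UNIV (h' \<omega>) \<and> (\<forall>\<xi>. 0 \<le> h' \<omega> \<xi>) \<and> (\<exists>\<xi>. h' \<omega> \<xi> = 0) \<and>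
        (\<forall>\<xi>. h' \<omega> \<xi> = 0 \<longrightarrow> h \<omega> \<xi> = 0 \<and> (\<forall>b\<in>B. \<xi> \<bullet> b = \<alpha> b \<omega>)))" (is "\<exists>h' \<alpha>. ?P B h' \<alpha>")
    if "finite B" for B :: "'a set"
    using that
  proof induction
    case empty
    show ?case
    proof -
      have "?P {} h (\<lambda>_ _. 0)"
        by (simp add: meas cont nonneg ex)
      then show ?thesis by blast
    qed
  next
    case (insert b B)
    then obtain h' \<alpha> where IH: "?P B h' \<alpha>"
      by blast
    have "\<exists>\<beta>\<in>borel_measurable N. \<forall>\<omega>\<in>G. \<exists>\<xi>. h' \<omega> \<xi> = 0 \<and> \<xi> \<bullet> b = \<beta> \<omega>"
    proof (rule measurable_minimum_over_zeros)
      show "bounded {\<xi>. h' \<omega> \<xi> = 0}" if "\<omega> \<in> G" for \<omega>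
        using IH that by (intro bounded_subset[OF bdd[OF that]]) auto
    qed (use IH in \<open>auto intro!: continuous_intros\<close>)
    then obtain \<beta> where \<beta>: "\<beta> \<in> borel_measurable N" "\<And>\<omega>. \<omega> \<in> G \<Longrightarrow> \<exists>\<xi>. h' \<omega> \<xi> = 0 \<and> \<xi> \<bullet> b = \<beta> \<omega>"
      by blast
    have "?P (insert b B) (\<lambda>\<omega> \<xi>. h' \<omega> \<xi> + \<bar>\<xi> \<bullet> b - \<beta> \<omega>\<bar>) (\<alpha>(b := \<beta>))"
    proof (intro conjI allI ballI impI)
      show "(\<lambda>\<omega>. h' \<omega> \<xi> + \<bar>\<xi> \<bullet> b - \<beta> \<omega>\<bar>) \<in> borel_measurable N" for \<xi>
        using IH \<beta>(1) by (intro borel_measurable_add borel_measurable_abs borel_measurable_diff) auto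
      show "(\<alpha>(b := \<beta>)) b' \<in> borel_measurable N" if "b' \<in> insert b B" for b'
        using IH \<beta>(1) that by auto
      fix \<omega> assume G: "\<omega> \<in> G"
      show "continuous_on UNIV (\<lambda>\<xi>. h' \<omega> \<xi> + \<bar>\<xi> \<bullet> b - \<beta> \<omega>\<bar>)"
        using IH G by (intro continuous_intros) auto
      have nn: "0 \<le> h' \<omega> \<xi>" for \<xi>
        using IH G by blast
      then show "0 \<le> h' \<omega> \<xi> + \<bar>\<xi> \<bullet> b - \<beta> \<omega>\<bar>" for \<xi>
        by (simp add: add_nonneg_nonneg)
      show "\<exists>\<xi>. h' \<omega> \<xi> + \<bar>\<xi> \<bullet> b - \<beta> \<omega>\<bar> = 0"
        using \<beta>(2)[OF G] by (metis abs_zero add_0 diff_self)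
      fix \<xi> assume "h' \<omega> \<xi> + \<bar>\<xi> \<bullet> b - \<beta> \<omega>\<bar> = 0"
      then have z: "h' \<omega> \<xi> = 0" "\<xi> \<bullet> b = \<beta> \<omega>"
        using nn[of \<xi>] by auto
      then show "h \<omega> \<xi> = 0"
        using IH G by blast
      show "\<xi> \<bullet> b' = (\<alpha>(b := \<beta>)) b' \<omega>" if "b' \<in> insert b B" for b'
        using IH G z that by auto
    qed
    then show ?case
      by (intro exI)
  qed
  from this[OF finite_Basis] obtain h' \<alpha> where P: "?P Basis h' \<alpha>"
    by blast
  show ?thesis
  proof (intro bexI[of _ "\<lambda>\<omega>. \<Sum>b\<in>Basis. \<alpha> b \<omega> *\<^sub>R b"] ballI)
    show "(\<lambda>\<omega>. \<Sum>b\<in>Basis. \<alpha> b \<omega> *\<^sub>R b) \<in> borel_measurable N"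
      using P by (intro borel_measurable_sum borel_measurable_scaleR) auto
    fix \<omega> assume "\<omega> \<in> G"
    then obtain \<xi> where "h \<omega> \<xi> = 0" "\<forall>b\<in>Basis. \<xi> \<bullet> b = \<alpha> b \<omega>"
      using P by blast
    moreover from this have "(\<Sum>b\<in>Basis. \<alpha> b \<omega> *\<^sub>R b) = \<xi>"
      by (metis (mono_tags, lifting) euclidean_representation sum.cong)
    ultimately show "h \<omega> (\<Sum>b\<in>Basis. \<alpha> b \<omega> *\<^sub>R b) = 0"
      by simp
  qed
qed

section \<open>Measurable recourse\<close>

lemma causal_op_cong:
  assumes "\<And>s. s \<in> {1..t} \<Longrightarrow> x s = x' s"
  shows "causal_op f x t = causal_op f x' t"
proof -
  have "(\<lambda>s\<in>{1..t}. x s \<omega>) = (\<lambda>s\<in>{1..t}. x' s \<omega>)" for \<omega>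
    using assms by (auto simp: restrict_def)
  then show ?thesis
    by (simp add: causal_op_def)
qed

text \<open>
  Recourse provides, for each \<open>\<omega>\<close> outside a null set, a point that satisfies the constraints of time
  \<open>t\<close> given the past and whose distance to \<open>\<eta> \<omega>\<close> is at most the bound \<open>R \<omega>\<close> of the conclusion. The
  admissible points within this distance are the zeros of the sum \<open>h\<close> of the two distances and the excess
  \<open>max 0 (norm (\<xi> - \<eta> \<omega>) - R \<omega>)\<close>. They form a bounded set, so that one of them can be
  selected measurably. The measurability of \<open>h\<close> in \<open>\<omega>\<close> rests on superpositional measurability,
  since the past inserted into \<open>f\<close> is random.
\<close>

lemma recourse_step:
  fixes f :: "nat \<Rightarrow> (nat \<Rightarrow> 'a::euclidean_space) \<Rightarrow> 'w \<Rightarrow> 'b::euclidean_space"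
    and X :: "nat \<Rightarrow> 'w \<Rightarrow> 'a set" and Y :: "nat \<Rightarrow> 'w \<Rightarrow> 'b set"
  assumes t: "1 \<le> t"
    and space: "space N = space M"
    and car: "caratheodory M N t (f t)"
    and sup: "superpositionally_measurable N t (f t)"
    and X: "measurable_multifunction N (X t)" "\<And>\<omega>. \<omega> \<in> space M \<Longrightarrow> closed (X t \<omega>)"
    and Y: "measurable_multifunction N (Y t)" "\<And>\<omega>. \<omega> \<in> space M \<Longrightarrow> closed (Y t \<omega>)"
    and rec: "AE \<omega> in M. \<forall>\<zeta> \<in> (\<Pi>\<^sub>E s\<in>{1..<t}. X s \<omega>). \<forall>\<eta>. \<exists>\<xi>.
          f t (\<zeta>(t := \<xi>)) \<omega> \<in> Y t \<omega> \<and> \<xi> \<in> X t \<omega> \<and>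
          norm (\<xi> - \<eta>) \<le> C * (infdist (f t (\<zeta>(t := \<eta>)) \<omega>) (Y t \<omega>) + infdist \<eta> (X t \<omega>))"
    and x: "\<And>s. s \<in> {1..<t} \<Longrightarrow> x s \<in> borel_measurable N"
    and xX: "\<And>s. s \<in> {1..<t} \<Longrightarrow> AE \<omega> in M. x s \<omega> \<in> X s \<omega>"
    and \<eta>: "\<eta> \<in> borel_measurable N"
  shows "\<exists>z\<in>borel_measurable N. AE \<omega> in M.
     causal_op f (x(t := z)) t \<omega> \<in> Y t \<omega> \<and> z \<omega> \<in> X t \<omega> \<and>
     norm (z \<omega> - \<eta> \<omega>) \<le> C * (infdist (causal_op f (x(t := \<eta>)) t \<omega>) (Y t \<omega>) + infdist (\<eta> \<omega>) (X t \<omega>))"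
proof -
  \<comment> \<open>Outside \<open>{1..<t}\<close> the past has the value \<open>undefined\<close>, so that updating it at \<open>t\<close> gives
    an element of \<open>{1..t} \<rightarrow>\<^sub>E UNIV\<close>.\<close>
  define past where "past = (\<lambda>\<omega>. \<lambda>s\<in>{1..<t}. x s \<omega>)"
  have past_upd: "(\<lambda>s\<in>{1..t}. (x(t := z)) s \<omega>) = (past \<omega>)(t := z \<omega>)" for z :: "'w \<Rightarrow> 'a" and \<omega>
    using t by (auto simp: past_def restrict_def)
  have f_meas: "(\<lambda>\<omega>. f t ((past \<omega>)(t := z \<omega>)) \<omega>) \<in> borel_measurable N"
    if "z \<in> borel_measurable N" for z
  proof -
    have "(\<lambda>\<omega>. \<lambda>s\<in>{1..t}. (x(t := z)) s \<omega>) \<in> measurable N (Pi\<^sub>M {1..t} (\<lambda>_. borel))"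
      using x that by (intro measurable_restrict) auto
    then have "(\<lambda>\<omega>. f t (\<lambda>s\<in>{1..t}. (x(t := z)) s \<omega>) \<omega>) \<in> borel_measurable N"
      by (rule sup[unfolded superpositionally_measurable_def, rule_format])
    then show ?thesis
      by (simp only: past_upd)
  qed
  define R where "R = (\<lambda>\<omega>. C * (infdist (f t ((past \<omega>)(t := \<eta> \<omega>)) \<omega>) (Y t \<omega>) + infdist (\<eta> \<omega>) (X t \<omega>)))"
  have R: "R \<in> borel_measurable N"
    unfolding R_def using X(1) Y(1) \<eta> f_meas
    by (intro borel_measurable_times borel_measurable_add borel_measurable_infdist_multifunction) auto
  define h where "h = (\<lambda>\<omega> \<xi>. infdist (f t ((past \<omega>)(t := \<xi>)) \<omega>) (Y t \<omega>) + infdist \<xi> (X t \<omega>)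
      + max 0 (norm (\<xi> - \<eta> \<omega>) - R \<omega>))"
  have h0: "h \<omega> \<xi> = 0 \<longleftrightarrow> infdist (f t ((past \<omega>)(t := \<xi>)) \<omega>) (Y t \<omega>) = 0 \<and>
      infdist \<xi> (X t \<omega>) = 0 \<and> norm (\<xi> - \<eta> \<omega>) \<le> R \<omega>" for \<omega> \<xi>
    unfolding h_def using infdist_nonneg[of "f t ((past \<omega>)(t := \<xi>)) \<omega>" "Y t \<omega>"] infdist_nonneg[of \<xi> "X t \<omega>"]
    by (auto simp: max_def)
  define G where "G = {\<omega> \<in> space M. continuous_on ({1..t} \<rightarrow>\<^sub>E UNIV) (\<lambda>\<zeta>. f t \<zeta> \<omega>) \<and>
      (\<forall>\<eta>. \<exists>\<xi>. f t ((past \<omega>)(t := \<xi>)) \<omega> \<in> Y t \<omega> \<and> \<xi> \<in> X t \<omega> \<and>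
          norm (\<xi> - \<eta>) \<le> C * (infdist (f t ((past \<omega>)(t := \<eta>)) \<omega>) (Y t \<omega>) + infdist \<eta> (X t \<omega>)))}"
  have AE_G: "AE \<omega> in M. \<omega> \<in> G"
  proof -
    have "AE \<omega> in M. \<forall>s\<in>{1..<t}. x s \<omega> \<in> X s \<omega>"
      using xX by (intro AE_finite_allI) auto
    moreover have "AE \<omega> in M. continuous_on ({1..t} \<rightarrow>\<^sub>E UNIV) (\<lambda>\<zeta>. f t \<zeta> \<omega>)"
      using car by (simp add: caratheodory_def)
    ultimately show ?thesis
      using rec AE_space
    proof eventually_elim
      case (elim \<omega>)
      have "past \<omega> \<in> (\<Pi>\<^sub>E s\<in>{1..<t}. X s \<omega>)"
        using elim(1) by (auto simp: past_def)
      with elim show ?case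
        by (simp add: G_def)
    qed
  qed
  have "\<exists>z\<in>borel_measurable N. \<forall>\<omega>\<in>G. h \<omega> (z \<omega>) = 0"
  proof (rule measurable_zero_selection)
    show "(\<lambda>\<omega>. h \<omega> \<xi>) \<in> borel_measurable N" for \<xi>
      unfolding h_def using X(1) Y(1) \<eta> R f_meas[of "\<lambda>_. \<xi>"]
      by (intro borel_measurable_add borel_measurable_max borel_measurable_diff
          borel_measurable_norm borel_measurable_infdist_multifunction) auto
  next
    fix \<omega> assume G: "\<omega> \<in> G"
    have "continuous_on UNIV (\<lambda>\<xi>. (past \<omega>)(t := \<xi>))"
    proof (rule continuous_on_coordinatewise_then_product)
      show "continuous_on UNIV (\<lambda>\<xi>. ((past \<omega>)(t := \<xi>)) i)" for i
        by (cases "i = t") (simp_all add: continuous_on_id)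
    qed
    moreover have "range (\<lambda>\<xi>. (past \<omega>)(t := \<xi>)) \<subseteq> {1..t} \<rightarrow>\<^sub>E UNIV"
      using t by (auto simp: past_def PiE_def extensional_def)
    moreover have "continuous_on ({1..t} \<rightarrow>\<^sub>E UNIV) (\<lambda>\<zeta>. f t \<zeta> \<omega>)"
      using G by (simp add: G_def)
    ultimately have "continuous_on UNIV (\<lambda>\<xi>. f t ((past \<omega>)(t := \<xi>)) \<omega>)"
      by (intro continuous_on_compose2[where f="\<lambda>\<xi>. (past \<omega>)(t := \<xi>)" and g="\<lambda>\<zeta>. f t \<zeta> \<omega>"])
    then show "continuous_on UNIV (h \<omega>)"
      unfolding h_def by (intro continuous_intros)
    show "0 \<le> h \<omega> \<xi>" for \<xi>
      unfolding h_def by (auto intro!: add_nonneg_nonneg infdist_nonneg)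
    show "\<exists>\<xi>. h \<omega> \<xi> = 0"
    proof -
      obtain \<xi> where "f t ((past \<omega>)(t := \<xi>)) \<omega> \<in> Y t \<omega>" "\<xi> \<in> X t \<omega>" "norm (\<xi> - \<eta> \<omega>) \<le> R \<omega>"
        using G unfolding G_def R_def by blast
      then show ?thesis
        by (intro exI[of _ \<xi>]) (simp add: h0)
    qed
    have "{\<xi>. h \<omega> \<xi> = 0} \<subseteq> cball (\<eta> \<omega>) (R \<omega>)"
      by (auto simp: h0 dist_norm norm_minus_commute)
    then show "bounded {\<xi>. h \<omega> \<xi> = 0}"
      using bounded_cball bounded_subset by blast
  qed
  then obtain z where z: "z \<in> borel_measurable N" "\<And>\<omega>. \<omega> \<in> G \<Longrightarrow> h \<omega> (z \<omega>) = 0"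
    by blast
  have co: "causal_op f (x(t := v)) t \<omega> = f t ((past \<omega>)(t := v \<omega>)) \<omega>" for v \<omega>
    by (simp only: causal_op_def past_upd)
  have "AE \<omega> in M. causal_op f (x(t := z)) t \<omega> \<in> Y t \<omega> \<and> z \<omega> \<in> X t \<omega> \<and>
     norm (z \<omega> - \<eta> \<omega>) \<le> C * (infdist (causal_op f (x(t := \<eta>)) t \<omega>) (Y t \<omega>) + infdist (\<eta> \<omega>) (X t \<omega>))"
    using AE_G
  proof eventually_elim
    case (elim \<omega>)
    then have ne: "X t \<omega> \<noteq> {}" "Y t \<omega> \<noteq> {}" and sp: "\<omega> \<in> space M"
      by (auto simp: G_def)
    have "h \<omega> (z \<omega>) = 0"
      using z(2) elim by blast
    then show ?case
      using ne X(2)[OF sp] Y(2)[OF sp]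
      by (simp add: h0 co R_def in_closed_iff_infdist_zero)
  qed
  then show ?thesis
    using z(1) by blast
qed

text \<open>
  The recourse steps are chained: by the inclusions between the \<open>\<sigma>\<close>-algebras, the components found
  before time \<open>t\<close> are a measurable past for the step at time \<open>t\<close>, and changing the component at \<open>t\<close>
  does not affect the constraints at earlier times.
\<close>

lemma recourse_process:
  fixes f :: "nat \<Rightarrow> (nat \<Rightarrow> 'a::euclidean_space) \<Rightarrow> 'w \<Rightarrow> 'b::euclidean_space"
    and X :: "nat \<Rightarrow> 'w \<Rightarrow> 'a set" and Y :: "nat \<Rightarrow> 'w \<Rightarrow> 'b set"
  assumes fil: "filtration_upto M \<F> T"
    and car: "\<And>t. t \<in> {1..T} \<Longrightarrow> caratheodory M (\<F> t) t (f t)"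
    and sup: "\<And>t. t \<in> {1..T} \<Longrightarrow> superpositionally_measurable (\<F> t) t (f t)"
    and X: "\<And>t. t \<in> {1..T} \<Longrightarrow> measurable_multifunction (\<F> t) (X t)"
      "\<And>t \<omega>. t \<in> {1..T} \<Longrightarrow> \<omega> \<in> space M \<Longrightarrow> closed (X t \<omega>)"
    and Y: "\<And>t. t \<in> {1..T} \<Longrightarrow> measurable_multifunction (\<F> t) (Y t)"
      "\<And>t \<omega>. t \<in> {1..T} \<Longrightarrow> \<omega> \<in> space M \<Longrightarrow> closed (Y t \<omega>)"
    and rec: "\<And>t. t \<in> {1..T} \<Longrightarrow> AE \<omega> in M. \<forall>\<zeta> \<in> (\<Pi>\<^sub>E s\<in>{1..<t}. X s \<omega>). \<forall>\<eta>. \<exists>\<xi>.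
          f t (\<zeta>(t := \<xi>)) \<omega> \<in> Y t \<omega> \<and> \<xi> \<in> X t \<omega> \<and>
          norm (\<xi> - \<eta>) \<le> C * (infdist (f t (\<zeta>(t := \<eta>)) \<omega>) (Y t \<omega>) + infdist \<eta> (X t \<omega>))"
    and \<eta>: "\<And>t. t \<in> {1..T} \<Longrightarrow> \<eta> t \<in> borel_measurable (\<F> t)"
  obtains x where "\<And>t. t \<in> {1..T} \<Longrightarrow> x t \<in> borel_measurable (\<F> t)"
    and "\<And>t. t \<in> {1..T} \<Longrightarrow> AE \<omega> in M. causal_op f x t \<omega> \<in> Y t \<omega> \<and> x t \<omega> \<in> X t \<omega>"
    and "\<And>t. t \<in> {1..T} \<Longrightarrow> AE \<omega> in M. norm (x t \<omega> - \<eta> t \<omega>) \<le>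
       C * (infdist (causal_op f (x(t := \<eta> t)) t \<omega>) (Y t \<omega>) + infdist (\<eta> t \<omega>) (X t \<omega>))"
proof -
  let ?P = "\<lambda>x t. x t \<in> borel_measurable (\<F> t) \<and> (AE \<omega> in M.
     causal_op f x t \<omega> \<in> Y t \<omega> \<and> x t \<omega> \<in> X t \<omega> \<and>
     norm (x t \<omega> - \<eta> t \<omega>) \<le>
       C * (infdist (causal_op f (x(t := \<eta> t)) t \<omega>) (Y t \<omega>) + infdist (\<eta> t \<omega>) (X t \<omega>)))"
  have "k \<le> T \<Longrightarrow> \<exists>x. \<forall>t\<in>{1..k}. ?P x t" for k
  proof (induction k)
    case (Suc k)
    let ?t = "Suc k"
    have tT: "?t \<in> {1..T}"
      using Suc.prems by simp
    obtain x where x: "\<And>t. t \<in> {1..k} \<Longrightarrow> ?P x t"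
      using Suc.IH[OF Suc_leD[OF Suc.prems]] by blast
    have "\<exists>z\<in>borel_measurable (\<F> ?t). AE \<omega> in M.
       causal_op f (x(?t := z)) ?t \<omega> \<in> Y ?t \<omega> \<and> z \<omega> \<in> X ?t \<omega> \<and>
       norm (z \<omega> - \<eta> ?t \<omega>) \<le>
         C * (infdist (causal_op f (x(?t := \<eta> ?t)) ?t \<omega>) (Y ?t \<omega>) + infdist (\<eta> ?t \<omega>) (X ?t \<omega>))"
    proof (rule recourse_step)
      show "1 \<le> ?t" by simp
      show "space (\<F> ?t) = space M"
        using fil tT by (auto simp: filtration_upto_def subalgebra_def)
      fix s assume s: "s \<in> {1..<?t}"
      then have sk: "s \<in> {1..k}" and sT: "s \<in> {1..T}" and "s \<le> ?t"
        using tT by auto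
      have "subalgebra (\<F> ?t) (\<F> s)"
        using fil tT sT \<open>s \<le> ?t\<close> by (auto simp: filtration_upto_def subalgebra_def)
      then show "x s \<in> borel_measurable (\<F> ?t)"
        using x[OF sk] measurable_from_subalg by blast
      show "AE \<omega> in M. x s \<omega> \<in> X s \<omega>"
        using x[OF sk] by auto
    qed ((rule car sup X Y rec \<eta>; (rule tT | assumption))+)
    then obtain z where z: "z \<in> borel_measurable (\<F> ?t)" "AE \<omega> in M.
       causal_op f (x(?t := z)) ?t \<omega> \<in> Y ?t \<omega> \<and> z \<omega> \<in> X ?t \<omega> \<and>
       norm (z \<omega> - \<eta> ?t \<omega>) \<le>
         C * (infdist (causal_op f (x(?t := \<eta> ?t)) ?t \<omega>) (Y ?t \<omega>) + infdist (\<eta> ?t \<omega>) (X ?t \<omega>))"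
      by blast
    have "?P (x(?t := z)) t" if "t \<in> {1..?t}" for t
    proof (cases "t = ?t")
      case True
      then show ?thesis using z by simp
    next
      case False
      then have t: "t \<in> {1..k}"
        using that by auto
      have "causal_op f (x(?t := z)) t = causal_op f x t"
        "causal_op f ((x(?t := z))(t := \<eta> t)) t = causal_op f (x(t := \<eta> t)) t"
        using t by (auto intro!: causal_op_cong)
      then show ?thesis
        using x[OF t] t by auto
    qed
    then show ?case by blast
  qed simp
  from this[OF order_refl] obtain x where x: "\<And>t. t \<in> {1..T} \<Longrightarrow> ?P x t"
    by blast
  show thesis
  proof (rule that[of x])
    fix t assume "t \<in> {1..T}"
    note x = x[OF this]
    show "x t \<in> borel_measurable (\<F> t)"
      using x by blast
    show "AE \<omega> in M. causal_op f x t \<omega> \<in> Y t \<omega> \<and> x t \<omega> \<in> X t \<omega>"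
      using x by auto
    show "AE \<omega> in M. norm (x t \<omega> - \<eta> t \<omega>) \<le>
       C * (infdist (causal_op f (x(t := \<eta> t)) t \<omega>) (Y t \<omega>) + infdist (\<eta> t \<omega>) (X t \<omega>))"
      using x by auto
  qed
qed

section \<open>Conditional expectation of vectors\<close>

lemma borel_measurable_vec_cond_exp:
  "vec_cond_exp M N x \<in> borel_measurable N"
  by (subst borel_measurable_euclidean_space)
    (auto simp: vec_cond_exp_def Basis_vec_def inner_axis)

lemma vec_cond_exp_of_measurable:
  fixes x :: "'w \<Rightarrow> real ^ 'n"
  assumes "prob_space M" "subalgebra M N" "integrable M x" "x \<in> borel_measurable N"
  shows "AE \<omega> in M. vec_cond_exp M N x \<omega> = x \<omega>"
proof -
  interpret prob_space M by fact
  interpret finite_measure_subalgebra M N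
    by unfold_locales fact
  have "AE \<omega> in M. real_cond_exp M N (\<lambda>\<omega>'. x \<omega>' $ i) \<omega> = x \<omega> $ i" for i
  proof (rule real_cond_exp_F_meas)
    show "integrable M (\<lambda>\<omega>. x \<omega> $ i)"
      by (rule integrable_bounded_linear[OF bounded_linear_vec_nth assms(3)])
    have "(\<lambda>\<omega>. x \<omega> \<bullet> axis i 1) \<in> borel_measurable N"
      using assms(4) by simp
    then show "(\<lambda>\<omega>. x \<omega> $ i) \<in> borel_measurable N"
      by (simp add: inner_axis)
  qed
  then have "AE \<omega> in M. \<forall>i\<in>UNIV. real_cond_exp M N (\<lambda>\<omega>'. x \<omega>' $ i) \<omega> = x \<omega> $ i"
    by (intro AE_finite_allI) auto
  then show ?thesis
    by eventually_elim (simp add: vec_cond_exp_def vec_eq_iff)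
qed


section \<open>Propagation of errors\<close>

text \<open>
  At each time, \<open>Z\<close> plus the sum of the errors so far grows at most by the factor \<open>1 + K\<close>.
\<close>

lemma discrete_Gronwall:
  fixes e :: "nat \<Rightarrow> real"
  assumes "0 \<le> K" and step: "\<And>t. t \<in> {1..T} \<Longrightarrow> e t \<le> K * (Z + (\<Sum>s\<in>{1..<t}. e s))"
  shows "Z + (\<Sum>s\<in>{1..T}. e s) \<le> (1 + K) ^ T * Z"
proof -
  have "k \<le> T \<Longrightarrow> Z + (\<Sum>s\<in>{1..k}. e s) \<le> (1 + K) ^ k * Z" for k
  proof (induction k)
    case (Suc k)
    let ?S = "Z + (\<Sum>s\<in>{1..k}. e s)"
    have "e (Suc k) \<le> K * ?S"
      using step[of "Suc k"] Suc.prems by (simp add: atLeastLessThanSuc_atLeastAtMost)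
    then have "Z + (\<Sum>s\<in>{1..Suc k}. e s) \<le> (1 + K) * ?S"
      by (simp add: algebra_simps)
    also have "\<dots> \<le> (1 + K) * ((1 + K) ^ k * Z)"
      using Suc assms(1) by (intro mult_left_mono) auto
    finally show ?case by simp
  qed simp
  then show ?thesis by simp
qed

lemma Lp_norm_le_process_norm:
  "t \<in> {1..T} \<Longrightarrow> Lp_norm M p (x t) \<le> process_norm M p T x"
  unfolding process_norm_def by (rule member_le_sum) (auto simp: Lp_norm_nonneg)

lemma process_norm_nonneg: "0 \<le> process_norm M p T x"
  unfolding process_norm_def by (intro sum_nonneg Lp_norm_nonneg)

text \<open>
  The pointwise bound on the correction at time \<open>t\<close> contains the residual of the constraint at the
  corrected past with \<open>\<eta>\<close> as the new component, whereas the residual of the given process \<open>x\<close> is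
  the one to be compared with. The difference \<open>d\<close> of the two values of the operator is controlled by
  its Lipschitz property between function spaces, applied to \<open>x\<close> and the hybrid process \<open>w\<close>, which
  equals the corrected process before \<open>t\<close>, \<open>\<eta>\<close> at \<open>t\<close>, and \<open>x\<close> itself after \<open>t\<close>. So the later components do not contribute to the distance between \<open>w\<close> and \<open>x\<close>, and the
  errors made before \<open>t\<close> enter with the factor \<open>C * L\<close>. Since \<open>\<eta>\<close> is \<open>x t - a\<close> almost surely,
  it is in \<open>L\<^sub>p\<close> because \<open>x t\<close> and \<open>a\<close> are.
\<close>

lemma recourse_step_estimate:
  fixes f :: "nat \<Rightarrow> (nat \<Rightarrow> 'a::euclidean_space) \<Rightarrow> 'w \<Rightarrow> 'b::euclidean_space"
    and X :: "nat \<Rightarrow> 'w \<Rightarrow> 'a set" and Y :: "nat \<Rightarrow> 'w \<Rightarrow> 'b set"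
  assumes p: "1 \<le> p" and C: "0 \<le> C" and L: "0 \<le> L" and t: "t \<in> {1..T}"
    and maps: "\<And>x. x \<in> process_Lp M p T \<Longrightarrow> causal_op f x \<in> process_Lp M p T"
    and lip: "\<And>x x'. x \<in> process_Lp M p T \<Longrightarrow> x' \<in> process_Lp M p T \<Longrightarrow>
      process_norm M p T (causal_op f x - causal_op f x') \<le> L * process_norm M p T (x - x')"
    and x: "x \<in> process_Lp M p T"
    and x': "\<And>s. s \<in> {1..<t} \<Longrightarrow> x' s \<in> Lp_space M M p"
    and x't: "x' t \<in> borel_measurable M"
    and \<eta>: "\<eta> \<in> borel_measurable M"
    and a: "a \<in> Lp_space M M p" "AE \<omega> in M. a \<omega> = x t \<omega> - \<eta> \<omega>"
    and y: "y \<in> Lp_selections M p (Y t)"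
    and u: "u \<in> Lp_selections M p (X t)"
    and bound: "AE \<omega> in M. norm (x' t \<omega> - \<eta> \<omega>) \<le>
      C * (infdist (causal_op f (x'(t := \<eta>)) t \<omega>) (Y t \<omega>) + infdist (\<eta> \<omega>) (X t \<omega>))"
  shows "x' t \<in> Lp_space M M p"
    and "Lp_norm M p (x' t - x t) \<le> Lp_norm M p a +
      C * (L * ((\<Sum>s\<in>{1..<t}. Lp_norm M p (x' s - x s)) + Lp_norm M p a) +
        Lp_norm M p (causal_op f x t - y) + Lp_norm M p a + Lp_norm M p (x t - u))"
proof -
  have p0: "0 < p" using p by simp
  have xs: "x s \<in> Lp_space M M p" if "s \<in> {1..T}" for s
    using x that by (auto simp: process_Lp_def)
  have xt: "x t \<in> Lp_space M M p" "x t \<in> borel_measurable M"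
    using xs[OF t] by (auto simp: Lp_space_def)
  have am: "a \<in> borel_measurable M"
    using a by (auto simp: Lp_space_def)
  have yu: "y \<in> Lp_space M M p" "AE \<omega> in M. y \<omega> \<in> Y t \<omega>" "u \<in> Lp_space M M p" "AE \<omega> in M. u \<omega> \<in> X t \<omega>"
    using y u by (auto simp: Lp_selections_def)
  have \<eta>Lp: "\<eta> \<in> Lp_space M M p"
  proof (rule Lp_dominated(1)[OF p0 Lp_diff[OF p xt(1) a(1)] \<eta>])
    show "AE \<omega> in M. norm (\<eta> \<omega>) \<le> norm (x t \<omega> - a \<omega>)"
      using a(2) by eventually_elim simp
  qed
  define w where "w = (\<lambda>s. if s < t then x' s else if s = t then \<eta> else x s)"
  have w: "w \<in> process_Lp M p T"
    using x' xs \<eta>Lp by (auto simp: process_Lp_def w_def)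
  have wt: "causal_op f (x'(t := \<eta>)) t = causal_op f w t"
    by (rule causal_op_cong) (auto simp: w_def)
  define d where "d = causal_op f w t - causal_op f x t"
  define b where "b = causal_op f x t - y"
  define c where "c = x t - u"
  have Fx: "causal_op f w t \<in> Lp_space M M p" "causal_op f x t \<in> Lp_space M M p"
    using maps[OF w] maps[OF x] t by (auto simp: process_Lp_def)
  have dbc: "d \<in> Lp_space M M p" "b \<in> Lp_space M M p" "c \<in> Lp_space M M p"
    using Lp_diff[OF p Fx] Lp_diff[OF p Fx(2) yu(1)] Lp_diff[OF p xt(1) yu(3)]
    by (simp_all add: d_def b_def c_def fun_diff_def)
  have \<eta>a: "Lp_norm M p (\<eta> - x t) = Lp_norm M p a"
  proof -
    have "Lp_norm M p (\<lambda>\<omega>. \<eta> \<omega> - x t \<omega>) = Lp_norm M p (\<lambda>\<omega>. - a \<omega>)"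
      using \<eta> xt(2) am by (intro Lp_norm_cong_AE) (use a(2) in \<open>auto elim: eventually_mono\<close>)
    then show ?thesis
      using Lp_uminus(2)[OF a(1)] by (simp add: fun_diff_def)
  qed
  have d_le: "Lp_norm M p d \<le> L * ((\<Sum>s\<in>{1..<t}. Lp_norm M p (x' s - x s)) + Lp_norm M p a)"
  proof -
    have "Lp_norm M p d \<le> process_norm M p T (causal_op f w - causal_op f x)"
      using Lp_norm_le_process_norm[OF t, of M p "causal_op f w - causal_op f x"] by (simp add: d_def)
    also have "\<dots> \<le> L * process_norm M p T (w - x)"
      by (rule lip[OF w x])
    also have "process_norm M p T (w - x) = (\<Sum>s\<in>{1..t}. Lp_norm M p (w s - x s))"
      unfolding process_norm_def
      using t by (intro sum.mono_neutral_cong_right) (auto simp: w_def Lp_norm_def)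
    also have "{1..t} = insert t {1..<t}"
      using t by auto
    also have "(\<Sum>s\<in>\<dots>. Lp_norm M p (w s - x s)) =
        (\<Sum>s\<in>{1..<t}. Lp_norm M p (x' s - x s)) + Lp_norm M p a"
      by (simp add: w_def \<eta>a)
    finally show ?thesis .
  qed
  define g where "g = (\<lambda>\<omega>. C *\<^sub>R (norm (d \<omega>) + norm (b \<omega>) + norm (a \<omega>) + norm (c \<omega>)))"
  note N = Lp_norm_of_norm[OF dbc(1)] Lp_norm_of_norm[OF dbc(2)] Lp_norm_of_norm[OF a(1)]
    Lp_norm_of_norm[OF dbc(3)]
  note S1 = Minkowski_Lp[OF p N(1,3)]
  note S2 = Minkowski_Lp[OF p S1(1) N(5)]
  note S3 = Minkowski_Lp[OF p S2(1) N(7)]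
  have gLp: "g \<in> Lp_space M M p"
    unfolding g_def by (rule Lp_scale(1)[OF p0 S3(1) C])
  have g_le: "Lp_norm M p g \<le> C * (Lp_norm M p d + Lp_norm M p b + Lp_norm M p a + Lp_norm M p c)"
    unfolding g_def Lp_scale(2)[OF p0 S3(1) C]
    using S1(2) S2(2) S3(2) N(2,4,6,8) C by (intro mult_left_mono) auto
  note ga = Minkowski_Lp[OF p gLp N(5)]
  have dom: "AE \<omega> in M. norm (x' t \<omega> - x t \<omega>) \<le> norm (g \<omega> + norm (a \<omega>))"
    using bound a(2) yu(2,4)
  proof eventually_elim
    case (elim \<omega>)
    have "infdist (causal_op f w t \<omega>) (Y t \<omega>) \<le> norm (causal_op f w t \<omega> - y \<omega>)"
      using infdist_le[OF elim(3)] by (simp add: dist_norm)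
    also have "\<dots> \<le> norm (d \<omega>) + norm (b \<omega>)"
      using norm_triangle_ineq[of "d \<omega>" "b \<omega>"] by (simp add: d_def b_def)
    finally have 1: "infdist (causal_op f w t \<omega>) (Y t \<omega>) \<le> norm (d \<omega>) + norm (b \<omega>)" .
    have "infdist (\<eta> \<omega>) (X t \<omega>) \<le> norm (\<eta> \<omega> - u \<omega>)"
      using infdist_le[OF elim(4)] by (simp add: dist_norm)
    also have "\<dots> \<le> norm (a \<omega>) + norm (c \<omega>)"
      using norm_triangle_ineq4[of "c \<omega>" "a \<omega>"] by (simp add: elim(2) c_def)
    finally have 2: "infdist (\<eta> \<omega>) (X t \<omega>) \<le> norm (a \<omega>) + norm (c \<omega>)" .
    have "norm (x' t \<omega> - \<eta> \<omega>) \<le> g \<omega>"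
      using elim(1) unfolding wt g_def real_scaleR_def
      by (rule order_trans) (use 1 2 C in \<open>auto intro!: mult_left_mono\<close>)
    moreover have "norm (x' t \<omega> - x t \<omega>) \<le> norm (x' t \<omega> - \<eta> \<omega>) + norm (a \<omega>)"
      using norm_triangle_ineq4[of "x' t \<omega> - \<eta> \<omega>" "a \<omega>"] by (simp add: elim(2))
    ultimately show ?case
      by simp
  qed
  have diffm: "(\<lambda>\<omega>. x' t \<omega> - x t \<omega>) \<in> borel_measurable M"
    using x't xt(2) by simp
  note e = Lp_dominated[OF p0 ga(1) diffm dom]
  show "x' t \<in> Lp_space M M p"
    using Minkowski_Lp(1)[OF p e(1) xt(1)] by simp
  have "Lp_norm M p (x' t - x t) \<le> Lp_norm M p g + Lp_norm M p a"
    using e(2) ga(2) N(6) by (simp add: fun_diff_def)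
  also have "\<dots> \<le> C * (L * ((\<Sum>s\<in>{1..<t}. Lp_norm M p (x' s - x s)) + Lp_norm M p a)
      + Lp_norm M p b + Lp_norm M p a + Lp_norm M p c) + Lp_norm M p a"
    by (intro add_right_mono order_trans[OF g_le] mult_left_mono d_le C)
  finally show "Lp_norm M p (x' t - x t) \<le> Lp_norm M p a +
      C * (L * ((\<Sum>s\<in>{1..<t}. Lp_norm M p (x' s - x s)) + Lp_norm M p a) +
        Lp_norm M p (causal_op f x t - y) + Lp_norm M p a + Lp_norm M p (x t - u))"
    by (simp add: b_def c_def add.commute)
qed

section \<open>Subregularity\<close>

theorem theorem4p4:
  fixes M :: "'w measure"
    and \<F> :: "nat \<Rightarrow> 'w measure"
    and p :: real
    and T :: nat
    and f :: "nat \<Rightarrow> (nat \<Rightarrow> real ^ 'n) \<Rightarrow> 'w \<Rightarrow> real ^ 'm"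
    and X :: "nat \<Rightarrow> 'w \<Rightarrow> (real ^ 'n) set"
    and Y :: "nat \<Rightarrow> 'w \<Rightarrow> (real ^ 'm) set"
  assumes "prob_space M"
    and "1 \<le> T"
    and "filtration_upto M \<F> T"
    and "1 \<le> p"
    and "\<And>t. t \<in> {1..T} \<Longrightarrow> caratheodory M (\<F> t) t (f t)"
    and "causal_operator M \<F> p T f"
    and "lipschitz_extension M p T f"
    and "\<And>t. t \<in> {1..T} \<Longrightarrow> measurable_multifunction (\<F> t) (X t)"
    and "\<And>t. t \<in> {1..T} \<Longrightarrow> measurable_multifunction (\<F> t) (Y t)"
    and "\<And>t \<omega>. t \<in> {1..T} \<Longrightarrow> \<omega> \<in> space M \<Longrightarrow> convex (X t \<omega>) \<and> closed (X t \<omega>)"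
    and "\<And>t \<omega>. t \<in> {1..T} \<Longrightarrow> \<omega> \<in> space M \<Longrightarrow> convex (Y t \<omega>) \<and> closed (Y t \<omega>)"
    and "complete_subregular_recourse M T f X Y"
  shows "\<forall>xh. feasible M \<F> p T f X Y xh \<longrightarrow>
           subregular_at (process_Lp M p T) (process_norm M p T) (residual_norm M p T)
             (residual M \<F> p T f X Y) xh"
proof (intro allI impI)
  interpret prob_space M by fact
  note p = \<open>1 \<le> p\<close>
  have sub: "subalgebra M (\<F> t)" if "t \<in> {1..T}" for t
    using assms(3) that by (auto simp: filtration_upto_def)
  obtain C where C: "0 \<le> C" "\<And>t. t \<in> {1..T} \<Longrightarrow> AE \<omega> in M.
      \<forall>\<zeta> \<in> (\<Pi>\<^sub>E s\<in>{1..<t}. X s \<omega>). \<forall>\<eta>. \<exists>\<xi>. f t (\<zeta>(t := \<xi>)) \<omega> \<in> Y t \<omega> \<and> \<xi> \<in> X t \<omega> \<and>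
        norm (\<xi> - \<eta>) \<le> C * (infdist (f t (\<zeta>(t := \<eta>)) \<omega>) (Y t \<omega>) + infdist \<eta> (X t \<omega>))"
  proof -
    obtain C' where C': "\<And>t. t \<in> {1..T} \<Longrightarrow> AE \<omega> in M.
      \<forall>\<zeta> \<in> (\<Pi>\<^sub>E s\<in>{1..<t}. X s \<omega>). \<forall>\<eta>. \<exists>\<xi>. f t (\<zeta>(t := \<xi>)) \<omega> \<in> Y t \<omega> \<and> \<xi> \<in> X t \<omega> \<and>
        norm (\<xi> - \<eta>) \<le> C' * (infdist (f t (\<zeta>(t := \<eta>)) \<omega>) (Y t \<omega>) + infdist \<eta> (X t \<omega>))"
      using assms(12) unfolding complete_subregular_recourse_def by blast
    have mono: "C' * (infdist v A + infdist w B) \<le> max C' 0 * (infdist v A + infdist w B)"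
      for v :: "real ^ 'm" and A and w :: "real ^ 'n" and B
      by (intro mult_right_mono) (auto intro: add_nonneg_nonneg infdist_nonneg)
    show ?thesis
    \<comment> \<open>The constant of the hypothesis may be negative, but the estimates are summed with a
      nonnegative factor.\<close>
    proof (rule that[of "max C' 0"])
      fix t assume "t \<in> {1..T}"
      from C'[OF this] show "AE \<omega> in M.
        \<forall>\<zeta> \<in> (\<Pi>\<^sub>E s\<in>{1..<t}. X s \<omega>). \<forall>\<eta>. \<exists>\<xi>. f t (\<zeta>(t := \<xi>)) \<omega> \<in> Y t \<omega> \<and> \<xi> \<in> X t \<omega> \<and>
          norm (\<xi> - \<eta>) \<le> max C' 0 * (infdist (f t (\<zeta>(t := \<eta>)) \<omega>) (Y t \<omega>) + infdist \<eta> (X t \<omega>))"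
        by eventually_elim (meson mono order_trans)
    qed simp
  qed
  have maps: "causal_op f x \<in> process_Lp M p T" if "x \<in> process_Lp M p T" for x
    using assms(7) that by (auto simp: lipschitz_extension_def)
  obtain L where L: "0 \<le> L" and lip: "\<And>x x'. x \<in> process_Lp M p T \<Longrightarrow> x' \<in> process_Lp M p T \<Longrightarrow>
      process_norm M p T (causal_op f x - causal_op f x') \<le> L * process_norm M p T (x - x')"
  proof -
    obtain L' where L': "\<And>x x'. x \<in> process_Lp M p T \<Longrightarrow> x' \<in> process_Lp M p T \<Longrightarrow>
      process_norm M p T (causal_op f x - causal_op f x') \<le> L' * process_norm M p T (x - x')"
      using assms(7) by (auto simp: lipschitz_extension_def)
    have "L' * process_norm M p T v \<le> max L' 0 * process_norm M p T v"
      for v :: "nat \<Rightarrow> 'w \<Rightarrow> real ^ 'n"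
      by (intro mult_right_mono process_norm_nonneg) simp
    then show ?thesis
      using L' by (intro that[of "max L' 0"]) (auto intro: order_trans)
  qed
  \<comment> \<open>With \<open>Z\<close> the norm of a residual and \<open>S\<close> the sum of the earlier errors, the error at time \<open>t\<close>
    is at most \<open>Z + C * (L * (S + Z) + Z)\<close>, and hence at most \<open>K * (Z + S)\<close>.\<close>
  define K where "K = 1 + C * (L + 1)"
  have K: "0 \<le> K"
    using C(1) L by (simp add: K_def)
  have KT: "0 < (1 + K) ^ T"
    using K by simp
  fix xh assume xh: "feasible M \<F> p T f X Y xh"
  have xhD: "xh \<in> process_Lp M p T"
    using xh by (simp add: feasible_def)
  have correct: "\<exists>x'\<in>process_Lp M p T. 0 \<in> residual M \<F> p T f X Y x' \<and>
      ennreal (process_norm M p T (x' - x)) \<le>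
        ennreal ((1 + K) ^ T) * (INF z\<in>residual M \<F> p T f X Y x. ennreal (residual_norm M p T z))"
    if x: "x \<in> process_Lp M p T" for x
  \<comment> \<open>If the residual set is empty, its distance to \<open>0\<close> is \<open>\<infinity>\<close> and any feasible process will do.
    Otherwise some residual \<open>(a, b, c)\<close> exists, and this is what makes the correction an \<open>L\<^sub>p\<close> process.\<close>
  proof (cases "residual M \<F> p T f X Y x = {}")
    case True
    then show ?thesis
      using xhD xh K by (intro bexI[of _ xh]) (simp_all add: zero_in_residual_iff_feasible ennreal_mult_top)
  next
    case False
    define \<eta> where "\<eta> = (\<lambda>t. vec_cond_exp M (\<F> t) (x t))"
    obtain x' where x'm: "\<And>t. t \<in> {1..T} \<Longrightarrow> x' t \<in> borel_measurable (\<F> t)"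
      and x'f: "\<And>t. t \<in> {1..T} \<Longrightarrow> AE \<omega> in M. causal_op f x' t \<omega> \<in> Y t \<omega> \<and> x' t \<omega> \<in> X t \<omega>"
      and x'b: "\<And>t. t \<in> {1..T} \<Longrightarrow> AE \<omega> in M. norm (x' t \<omega> - \<eta> t \<omega>) \<le>
         C * (infdist (causal_op f (x'(t := \<eta> t)) t \<omega>) (Y t \<omega>) + infdist (\<eta> t \<omega>) (X t \<omega>))"
    proof (rule recourse_process)
      show "superpositionally_measurable (\<F> t) t (f t)" if "t \<in> {1..T}" for t
        using assms(6) that by (simp add: causal_operator_def)
      show "\<eta> t \<in> borel_measurable (\<F> t)" for t
        by (simp add: \<eta>_def borel_measurable_vec_cond_exp)
    qed (use assms C(2) in blast)+
    \<comment> \<open>The process \<open>x'\<close> has been chosen before the residual \<open>z\<close>, so that the estimate for all \<open>z\<close>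
      passes to the infimum.\<close>
    have est: "(\<forall>t\<in>{1..T}. x' t \<in> Lp_space M M p) \<and>
        process_norm M p T (x' - x) \<le> (1 + K) ^ T * residual_norm M p T z"
      if z: "z \<in> residual M \<F> p T f X Y x" for z
    proof -
      obtain a b c where abc: "z = (a, b, c)"
        by (cases z)
      define Z where "Z = residual_norm M p T z"
      have Z: "0 \<le> Z"
        by (simp add: Z_def abc residual_norm_def process_norm_nonneg)
      have step: "x' t \<in> Lp_space M M p \<and>
          Lp_norm M p (x' t - x t) \<le> K * (Z + (\<Sum>s\<in>{1..<t}. Lp_norm M p (x' s - x s)))"
        if "t \<in> {1..T}" for t
        using that
      proof (induction t rule: less_induct)
        case (less t)
        note t = less.prems
        let ?S = "\<Sum>s\<in>{1..<t}. Lp_norm M p (x' s - x s)"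
        have past: "x' s \<in> Lp_space M M p" if "s \<in> {1..<t}" for s
          using less.IH[of s] that t by auto
        have a: "a t \<in> Lp_space M M p" "AE \<omega> in M. a t \<omega> = x t \<omega> - \<eta> t \<omega>"
          using z t by (auto simp: abc residual_def \<eta>_def)
        obtain y u where y: "y \<in> Lp_selections M p (Y t)" "b t = causal_op f x t - y"
          and u: "u \<in> Lp_selections M p (X t)" "c t = x t - u"
          using z t by (fastforce simp: abc residual_def)
        have x'M: "x' t \<in> borel_measurable M" and \<eta>M: "\<eta> t \<in> borel_measurable M"
          unfolding \<eta>_def
          by (rule measurable_from_subalg[OF sub[OF t]], rule x'm[OF t] borel_measurable_vec_cond_exp)+
        note e = recourse_step_estimate[where f=f and x=x and x'=x' and t=t and X=X and Y=Y and \<eta>="\<eta> t" and a="a t",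
            OF p C(1) L t maps lip x past x'M \<eta>M a y(1) u(1) x'b[OF t]]
        have ABC: "Lp_norm M p (a t) + Lp_norm M p (b t) + Lp_norm M p (c t) \<le> Z"
          unfolding Z_def abc residual_norm_def prod.case
          by (intro add_mono Lp_norm_le_process_norm t)
        have AZ: "Lp_norm M p (a t) \<le> Z"
          using ABC Lp_norm_nonneg[of M p "b t"] Lp_norm_nonneg[of M p "c t"] by linarith
        have "0 \<le> ?S"
          by (intro sum_nonneg Lp_norm_nonneg)
        have "Lp_norm M p (x' t - x t) \<le> Lp_norm M p (a t) + C * (L * (?S + Lp_norm M p (a t)) +
            (Lp_norm M p (a t) + Lp_norm M p (b t) + Lp_norm M p (c t)))"
          using e(2) by (simp add: y(2) u(2) add_ac)
        also have "\<dots> \<le> Z + C * (L * (?S + Z) + Z)"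
          using AZ ABC C(1) L by (intro add_mono mult_left_mono order_refl) auto
        also have "\<dots> \<le> K * (Z + ?S)"
          using \<open>0 \<le> ?S\<close> C(1) Z by (simp add: K_def algebra_simps)
        finally show ?case
          using e(1) by blast
      qed
      have "process_norm M p T (x' - x) \<le> Z + (\<Sum>s\<in>{1..T}. Lp_norm M p (x' s - x s))"
        using Z by (simp add: process_norm_def)
      also have "\<dots> \<le> (1 + K) ^ T * Z"
        using step by (intro discrete_Gronwall K) blast
      finally show ?thesis
        using step by (auto simp: Z_def)
    qed
    have x'D: "x' \<in> process_Lp M p T"
      using est False by (auto simp: process_Lp_def)
    have "feasible M \<F> p T f X Y x'"
      unfolding feasible_def
    proof (intro conjI ballI x'D)
      fix t assume t: "t \<in> {1..T}"
      have Lp: "x' t \<in> Lp_space M M p" "causal_op f x' t \<in> Lp_space M M p"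
        using x'D maps[OF x'D] t by (auto simp: process_Lp_def)
      show "AE \<omega> in M. x' t \<omega> - vec_cond_exp M (\<F> t) (x' t) \<omega> = 0"
        using vec_cond_exp_of_measurable[OF assms(1) sub[OF t] Lp_imp_integrable[OF assms(1) p Lp(1)] x'm[OF t]]
        by eventually_elim simp
      show "causal_op f x' t \<in> Lp_selections M p (Y t)" "x' t \<in> Lp_selections M p (X t)"
        using Lp x'f[OF t] by (auto simp: Lp_selections_def)
    qed
    moreover have "ennreal (process_norm M p T (x' - x)) \<le>
        ennreal ((1 + K) ^ T) * (INF z\<in>residual M \<F> p T f X Y x. ennreal (residual_norm M p T z))"
    proof -
      let ?n = "process_norm M p T (x' - x)"
      have "ennreal (?n / (1 + K) ^ T) \<le> (INF z\<in>residual M \<F> p T f X Y x. ennreal (residual_norm M p T z))"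
        using est KT by (intro INF_greatest ennreal_leI) (simp add: divide_le_eq mult.commute)
      then have "ennreal ((1 + K) ^ T) * ennreal (?n / (1 + K) ^ T) \<le>
          ennreal ((1 + K) ^ T) * (INF z\<in>residual M \<F> p T f X Y x. ennreal (residual_norm M p T z))"
        by (rule mult_left_mono) simp
      moreover have "ennreal ((1 + K) ^ T) * ennreal (?n / (1 + K) ^ T) = ennreal ?n"
        using K by (subst ennreal_mult'[symmetric]) (simp_all add: process_norm_nonneg)
      ultimately show ?thesis by simp
    qed
    ultimately show ?thesis
      using x'D by (auto simp: zero_in_residual_iff_feasible)
  qed
  show "subregular_at (process_Lp M p T) (process_norm M p T) (residual_norm M p T)
      (residual M \<F> p T f X Y) xh"
    \<comment> \<open>The estimate is global; the radius \<open>1\<close> is an arbitrary choice.\<close>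
    unfolding subregular_at_def
    using xhD xh correct KT
    by (intro conjI exI[of _ "1::real"] exI[of _ "(1 + K) ^ T"]) (auto simp: zero_in_residual_iff_feasible)
qed

end
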